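(* Suppose: (i) for each $z\in\mathcal Z$, $c(z,\cdot)$ is Lipschitz continuous on $\mathcal Y$ with Lipschitz constant $L(z)$ satisfying $\sup_{z\in\mathcal Z}L(z)<+\infty$; (ii) for a.e. $x\in\mathcal X$, $\sup_{z\in\mathcal Z}\mathbb E[(c(z,f^*(x)+\varepsilon))^2]<+\infty$ and $$\sup_{z\in\mathcal Z}\Big|\tfrac1n\sum_{i=1}^n(c(z,f^*(x)+\varepsilon^i))^2-\mathbb E[(c(z,f^*(x)+\varepsilon))^2]\Big|\xrightarrow{p}0;$$ (iii) $\sqrt n\,(g^*_n(\cdot;x)-g(\cdot;x))\xrightarrow{d}V(\cdot;x)$ for a.e. $x\in\mathcal X$, where $g^*_n(\cdot;x)$, $g(\cdot;x)$ and $V(\cdot;x)$ are (random) elements of $C(\mathcal Z)$; (iv) there is a constant $0<r\le1$ (independent of $n$) such that, for a.e. $x\in\mathcal X$, $$\|f^*(x)-\hat f_n(x)\|^2=O_p(n^{-r}),\qquad \tfrac1n\sum_{i=1}^n\|f^*(x^i)-\hat f_n(x^i)\|^2=O_p(n^{-r});$$ (v) with this $r$, the radius $\zeta_n(x)$ is chosen such that $\sup_{p\in\mathfrak P_n(x;\zeta_n(x))}\sum_{i=1}^n(p_i-\frac1n)^2=O(n^{-(1+r)})$ for a.e. $x\in\mathcal X$, and the radius $\mu_n(x)$ satisfies $\mu_n(x)=O(n^{-r/2})$ for a.e. $x\in\mathcal X$. Then, for a.e. $x\in\mathcal X$, the optimal value $\hat v^{DRO}_n(x)$ and an optimal solution $\hat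 z^{DRO}_n(x)$ of the ER-DRO problem satisfy $$|\hat v^{DRO}_n(x)-v^*(x)|=O_p(n^{-r/2}),\qquad |g(\hat z^{DRO}_n(x);x)-v^*(x)|=O_p(n^{-r/2}).$$
   Context: Setup. $Y=f^*(X)+\varepsilon$, where $X$ is a random vector with support $\mathcal X\subseteq\mathbb R^{d_x}$ and distribution $P_X$, $Y$ has nonempty convex support $\mathcal Y\subseteq\mathbb R^{d_y}$, $f^*(x):=\mathbb E[Y\mid X=x]$, and the zero-mean error $\varepsilon$ is independent of $X$. "A.e. $x$" is with respect to $P_X$. $\|\cdot\|$ is the Euclidean norm; $C(\mathcal Z)$ is the Banach space of real continuous functions on $\mathcal Z$ with the supremum norm. $\mathcal Z\subseteq\mathbb R^{d_z}$ is nonempty and compact, $c:\mathcal Z\times\mathcal Y\to\mathbb R$, $\mathbb E|c(z,f^*(x)+\varepsilon)|<\infty$ for each $z\in\mathcal Z$ and a.e. $x$, and $g(z;x):=\mathbb E[c(z,f^*(x)+\varepsilon)]$ is lower semicontinuous in $z$ on $\mathcal Z$ for a.e. $x$. The true problem is $v^*(x):=\min_{z\in\mathcal Z}g(z;x)$. All functions, sets and selections are assumed measurable. Data. $\mathcal D_n=\{(y^i,x^i)\}_{i=1}^n$ are joint observations of $(Y,X)$, $\varepsilon^i:=y^i-f^*(x^i)$; $\hat f_n$ is an estimate of $f^*$ built from $\mathcal D_n$ by a regression method, with residuals $\hat\varepsilon^i_n:=y^i-\hat f_n(x^i)$. Convergence in probability/distribution and $O_p$ refer to the data; $V_n=O_p(W_n)$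 means $V_n=R_nW_n$ with $\{R_n\}$ bounded in probability. $g^*_n(z;x):=\frac1n\sum_{i=1}^nc(z,f^*(x)+\varepsilon^i)$. $\mathrm{proj}_{\mathcal Y}$ is the orthogonal projection onto $\mathcal Y$. Ambiguity set. For nonnegative radii $\mu_n(x),\zeta_n(x)$, $$\hat{\mathcal P}_n(x):=\Big\{Q=\sum_{i=1}^np_i\delta_{\bar y^i}: p\in\mathfrak P_n(x;\zeta_n(x)),\ \bar y^i\in\hat{\mathcal Y}^i_n(x;\mu_n(x)),\ i=1,\dots,n\Big\},$$ $$\hat{\mathcal Y}^i_n(x;\mu):=\{y\in\mathcal Y:\|y-\mathrm{proj}_{\mathcal Y}(\hat f_n(x)+\hat\varepsilon^i_n)\|\le\mu\},$$ where $\delta$ is the Dirac measure and $\mathfrak P_n(x;\zeta)\subseteq\mathbb R^n$ is a given family of sets of probability vectors ($p\ge0$, $\sum_ip_i=1$ for all $p\in\mathfrak P_n(x;\zeta)$) with $\lim_{\zeta\downarrow0}\mathfrak P_n(x;\zeta)=\mathfrak P_n(x;0)=\{(\frac1n,\dots,\frac1n)\}$ for each $x$. ER-DRO problem. $\hat v^{DRO}_n(x)=\min_{z\in\mathcal Z}\sup_{Q\in\hat{\mathcal P}_n(x)}\mathbb E_{Y\sim Q}[c(z,Y)]$, with optimal solution $\hat z^{DRO}_n(x)$; its objective is assumed real-valued and lower semicontinuous on $\mathcal Z$ for each $x$. *)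

theory Defs
  imports "HOL-Probability.Probability" "HOL-Library.Landau_Symbols"
begin

definition dist_support :: "'a::topological_space measure \<Rightarrow> 'a set" where
  "dist_support P = {x. \<forall>U. open U \<and> x \<in> U \<longrightarrow> emeasure P U > 0}"

text \<open>\<open>f\<close> is a version of the regression function \<open>x \<mapsto> E[Y | X = x]\<close>; as the library's conditional
  expectation is real-valued, the defining property is stated for each coordinate of \<open>Y\<close>.\<close>
definition regression_function ::
    "'w measure \<Rightarrow> ('w \<Rightarrow> 'x::euclidean_space) \<Rightarrow> ('w \<Rightarrow> 'y::euclidean_space) \<Rightarrow> ('x \<Rightarrow> 'y) \<Rightarrow> bool" where
  "regression_function M X Y f \<longleftrightarrow>
     integrable M Y \<and> f \<in> borel_measurable borel \<and>
     (\<forall>b\<in>Basis. AE \<omega> in M.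
        real_cond_exp M (vimage_algebra (space M) X borel) (\<lambda>\<omega>. Y \<omega> \<bullet> b) \<omega> = f (X \<omega>) \<bullet> b)"

definition lsc_on :: "'a::topological_space set \<Rightarrow> ('a \<Rightarrow> real) \<Rightarrow> bool" where
  "lsc_on S f \<longleftrightarrow> (\<forall>z\<in>S. \<forall>a<f z. eventually (\<lambda>w. a < f w) (at z within S))"


section \<open>Stochastic convergence\<close>

text \<open>Sample sizes are \<open>n \<ge> 1\<close>; the value of a sequence at \<open>n = 0\<close> is irrelevant throughout.\<close>

definition bounded_in_prob :: "'w measure \<Rightarrow> (nat \<Rightarrow> 'w \<Rightarrow> real) \<Rightarrow> bool" where
  "bounded_in_prob M R \<longleftrightarrow>
     (\<forall>n\<ge>1. R n \<in> borel_measurable M) \<and>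
     (\<forall>\<delta>>0. \<exists>K. \<forall>n\<ge>1. measure M {\<omega>\<in>space M. \<bar>R n \<omega>\<bar> > K} \<le> \<delta>)"

definition stoch_bigo :: "'w measure \<Rightarrow> (nat \<Rightarrow> 'w \<Rightarrow> real) \<Rightarrow> (nat \<Rightarrow> real) \<Rightarrow> bool" where
  "stoch_bigo M V W \<longleftrightarrow>
     (\<exists>R. bounded_in_prob M R \<and> (\<forall>n\<ge>1. \<forall>\<omega>\<in>space M. V n \<omega> = R n \<omega> * W n))"

text \<open>Convergence in probability to \<open>0\<close> of nonnegative variables. They are extended real so that
  a supremum over an infinite family, which may be infinite at some sample points, is admitted.\<close>
definition tendsto_0_in_prob :: "'w measure \<Rightarrow> (nat \<Rightarrow> 'w \<Rightarrow> ereal) \<Rightarrow> bool" where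
  "tendsto_0_in_prob M S \<longleftrightarrow>
     (\<forall>n\<ge>1. S n \<in> borel_measurable M) \<and>
     (\<forall>\<delta>>0. (\<lambda>n. measure M {\<omega>\<in>space M. S n \<omega> > ereal \<delta>}) \<longlonglongrightarrow> 0)"

definition borel_of_metric :: "'a metric \<Rightarrow> 'a measure" where
  "borel_of_metric m = sigma (mspace m) {U. openin (mtopology_of m) U}"

definition conv_in_distribution ::
    "'a metric \<Rightarrow> 'w measure \<Rightarrow> (nat \<Rightarrow> 'w \<Rightarrow> 'a) \<Rightarrow> 'v measure \<Rightarrow> ('v \<Rightarrow> 'a) \<Rightarrow> bool" where
  "conv_in_distribution m M W N V \<longleftrightarrow>
     (\<forall>\<Phi>::'a \<Rightarrow> real. continuous_map (mtopology_of m) euclideanreal \<Phi> \<and> bounded (\<Phi> ` mspace m) \<longrightarrow>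
        (\<lambda>n. \<integral>\<omega>. \<Phi> (W n \<omega>) \<partial>M) \<longlonglongrightarrow> (\<integral>\<omega>. \<Phi> (V \<omega>) \<partial>N))"

text \<open>The space \<open>C(S)\<close> with the supremum metric, for compact \<open>S\<close>. Its elements are the continuous
  functions on \<open>S\<close>, represented as extensional functions (of the form \<open>\<lambda>z\<in>S. h z\<close>).\<close>
definition C_space :: "'a::topological_space set \<Rightarrow> ('a \<Rightarrow> real) metric" where
  "C_space S = cfunspace (top_of_set S) euclidean_metric"


section \<open>Ambiguity sets\<close>

text \<open>Vectors in \<open>\<real>\<^sup>n\<close>, with \<open>n\<close> varying, are functions on \<open>nat\<close> that vanish outside \<open>{1..n}\<close>;
  the product topology restricts to the usual topology of \<open>\<real>\<^sup>n\<close> on these.\<close>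

definition prob_vectors :: "nat \<Rightarrow> (nat \<Rightarrow> real) set" where
  "prob_vectors n = {p. (\<forall>i. p i \<ge> 0) \<and> (\<forall>i. i \<notin> {1..n} \<longrightarrow> p i = 0) \<and> (\<Sum>i=1..n. p i) = 1}"

definition uniform_weights :: "nat \<Rightarrow> nat \<Rightarrow> real" where
  "uniform_weights n i = (if i \<in> {1..n} then 1 / real n else 0)"

text \<open>Limits of set-valued maps in the sense of Painleve and Kuratowski: the outer and the inner
  limit coincide with \<open>T\<close>.\<close>

definition outer_limit :: "('a \<Rightarrow> 'b::topological_space set) \<Rightarrow> 'a filter \<Rightarrow> 'b set" where
  "outer_limit S F = {u. \<forall>U. open U \<and> u \<in> U \<longrightarrow> frequently (\<lambda>t. S t \<inter> U \<noteq> {}) F}"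

definition inner_limit :: "('a \<Rightarrow> 'b::topological_space set) \<Rightarrow> 'a filter \<Rightarrow> 'b set" where
  "inner_limit S F = {u. \<forall>U. open U \<and> u \<in> U \<longrightarrow> eventually (\<lambda>t. S t \<inter> U \<noteq> {}) F}"

definition set_tendsto :: "('a \<Rightarrow> 'b::topological_space set) \<Rightarrow> 'b set \<Rightarrow> 'a filter \<Rightarrow> bool" where
  "set_tendsto S T F \<longleftrightarrow> outer_limit S F = T \<and> inner_limit S F = T"

text \<open>The measure \<open>\<Sum>i=1..n. p i \<cdot> \<delta>(ybar i)\<close>, as an image of the measure with point masses \<open>p i\<close>.\<close>
definition weighted_dirac :: "nat \<Rightarrow> (nat \<Rightarrow> real) \<Rightarrow> (nat \<Rightarrow> 'y::euclidean_space) \<Rightarrow> 'y measure" where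
  "weighted_dirac n p ybar = distr (point_measure {1..n} (\<lambda>i. ennreal (p i))) borel ybar"

lemma emeasure_weighted_dirac:
  assumes "A \<in> sets borel"
  shows "emeasure (weighted_dirac n p ybar) A = (\<Sum>i=1..n. ennreal (p i) * indicator A (ybar i))"
proof -
  have "emeasure (weighted_dirac n p ybar) A =
      emeasure (point_measure {1..n} (\<lambda>i. ennreal (p i))) (ybar -` A \<inter> {1..n})"
    unfolding weighted_dirac_def using assms
    by (subst emeasure_distr) (auto simp: space_point_measure)
  also have "\<dots> = (\<Sum>i\<in>ybar -` A \<inter> {1..n}. ennreal (p i))"
    by (rule emeasure_point_measure_finite) auto
  also have "\<dots> = (\<Sum>i=1..n. ennreal (p i) * indicator A (ybar i))"
    by (rule sum.mono_neutral_cong_left) (auto simp: indicator_def)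
  finally show ?thesis .
qed

text \<open>The set \<open>{y \<in> S : \<parallel>y - proj\<^sub>S a\<parallel> \<le> \<rho>}\<close>.\<close>
definition proj_ball :: "'y::euclidean_space set \<Rightarrow> 'y \<Rightarrow> real \<Rightarrow> 'y set" where
  "proj_ball S a \<rho> = {y \<in> S. norm (y - closest_point S a) \<le> \<rho>}"

definition ambiguity_set ::
    "nat \<Rightarrow> (nat \<Rightarrow> real) set \<Rightarrow> (nat \<Rightarrow> 'y::euclidean_space set) \<Rightarrow> 'y measure set" where
  "ambiguity_set n \<PP> B =
     {weighted_dirac n p ybar | p ybar. p \<in> \<PP> \<and> (\<forall>i\<in>{1..n}. ybar i \<in> B i)}"

end

(*
  Fix x. On an event of probability close to one, every distribution Q = sum_i p_i delta(ybar_i) in the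
  ambiguity set satisfies, uniformly in z, |E_Q c(z,.) - g(z;x)| = O(n^(-r/2)), by splitting through
  sum_i p_i c(z, e_i) and g*_n(z;x) = (1/n) sum_i c(z, e_i), where e_i = f*(x) + eps^i:
  - as e_i lies in the closed convex set Y almost surely and the projection is nonexpansive,
    |ybar_i - e_i| <= mu + |f*(x) - fhat(x)| + |f*(x^i) - fhat(x^i)|, so the Lipschitz condition applies;
  - changing the weights from p to 1/n is controlled by Cauchy-Schwarz with (v), once against the
    regression errors and once against the second moments of c bounded by (ii);
  - convergence in distribution makes the sup norm of sqrt n (g*_n - g) tight.
  Two functions that are uniformly B-close have B-close infima, and a minimizer of one is
  2B-optimal for the other.
*)
theory Submission
  imports Defs
begin

section \<open>Supports of distributions and freezing one of two independent variables\<close>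

text \<open>The complement is the union of all open null sets. Closedness is what later makes the
  projection onto the support of \<open>Y\<close> nonexpansive.\<close>

lemma closed_dist_support: "closed (dist_support P)"
proof -
  have "- dist_support P = \<Union>{U. open U \<and> emeasure P U = 0}"
    by (auto simp: dist_support_def zero_less_iff_neq_zero)
  then have "open (- dist_support P)"
    by (metis (no_types, lifting) mem_Collect_eq open_Union)
  then show ?thesis
    by (simp add: closed_def)
qed

text \<open>The open null sets may be uncountably many; by the Lindelof property a countable
  subfamily has the same union, which is therefore null.\<close>

lemma AE_in_dist_support:
  fixes P :: "'a::second_countable_topology measure"
  assumes "sets P = sets borel"
  shows "AE x in P. x \<in> dist_support P"
proof -
  define \<F> where "\<F> = {U. open U \<and> emeasure P U = 0}"
  have "\<And>U. U \<in> \<F> \<Longrightarrow> open U"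
    by (simp add: \<F>_def)
  then obtain \<F>' where \<F>': "\<F>' \<subseteq> \<F>" "countable \<F>'" "\<Union>\<F>' = \<Union>\<F>"
    by (metis Lindelof)
  have "\<Union>\<F>' \<in> null_sets P"
    using \<F>'(1) assms
    by (intro null_sets_UN'[OF \<F>'(2), of "\<lambda>U. U", simplified]) (auto simp: \<F>_def null_sets_def)
  then have "AE x in P. x \<notin> \<Union>\<F>'"
    by (rule AE_not_in)
  then show ?thesis
    by (rule AE_mp) (auto intro!: AE_I2 simp: \<F>'(3) \<F>_def dist_support_def zero_less_iff_neq_zero)
qed

context prob_space
begin

text \<open>Independence makes the law of the pair the product of the marginal laws, and Fubini then
  turns an almost sure property of \<open>(X, E)\<close> into one of \<open>(x, E)\<close> for
  almost every fixed \<open>x\<close>. It serves to replace the random \<open>X\<close> by a given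
  covariate while the error stays random.\<close>

lemma AE_indep_set_vimage:
  fixes E :: "'a \<Rightarrow> 'b" and X :: "'a \<Rightarrow> 'c"
  assumes E: "E \<in> measurable M S" and X: "X \<in> measurable M T"
    and indep: "indep_set (sets (vimage_algebra (space M) E S)) (sets (vimage_algebra (space M) X T))"
    and Pm: "Measurable.pred (T \<Otimes>\<^sub>M S) (case_prod P)"
    and P: "AE \<omega> in M. P (X \<omega>) (E \<omega>)"
  shows "AE x in distr M T X. AE \<omega> in M. P x (E \<omega>)"
proof -
  interpret dX: prob_space "distr M T X" by (rule prob_space_distr) (rule X)
  interpret dE: prob_space "distr M S E" by (rule prob_space_distr) (rule E)
  interpret pair_sigma_finite "distr M T X" "distr M S E" ..
  have eq: "distr M T X \<Otimes>\<^sub>M distr M S E = distr M (T \<Otimes>\<^sub>M S) (\<lambda>\<omega>. (X \<omega>, E \<omega>))"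
  proof (rule pair_measure_eqI)
    fix A B assume "A \<in> sets (distr M T X)" "B \<in> sets (distr M S E)"
    then have AB: "A \<in> sets T" "B \<in> sets S" by auto
    have "prob ((E -` B \<inter> space M) \<inter> (X -` A \<inter> space M))
        = prob (E -` B \<inter> space M) * prob (X -` A \<inter> space M)"
      using indep AB E X by (intro indep_setD) (auto intro: in_vimage_algebra)
    moreover have "(E -` B \<inter> space M) \<inter> (X -` A \<inter> space M) = (\<lambda>\<omega>. (X \<omega>, E \<omega>)) -` (A \<times> B) \<inter> space M"
      by auto
    ultimately show "emeasure (distr M T X) A * emeasure (distr M S E) B
        = emeasure (distr M (T \<Otimes>\<^sub>M S) (\<lambda>\<omega>. (X \<omega>, E \<omega>))) (A \<times> B)"
      using AB E X by (simp add: emeasure_distr emeasure_eq_measure mult.commute flip: ennreal_mult)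
  qed (auto simp: dX.sigma_finite_measure_axioms dE.sigma_finite_measure_axioms)
  have "AE p in distr M T X \<Otimes>\<^sub>M distr M S E. case_prod P p"
    unfolding eq using P E X Pm by (subst AE_distr_iff) auto
  then have "AE x in distr M T X. AE y in distr M S E. P x y"
    by (auto dest: AE_pair)
  then show ?thesis
  proof (rule AE_mp[OF _ AE_I2[OF impI]])
    fix x assume "x \<in> space (distr M T X)" and A: "AE y in distr M S E. P x y"
    then have x: "x \<in> space T" by simp
    have "Measurable.pred S (P x)"
      using measurable_compose[OF measurable_Pair1'[OF x] Pm] by simp
    with A show "AE \<omega> in M. P x (E \<omega>)"
      using E by (subst (asm) AE_distr_iff) auto
  qed
qed

end

section \<open>Reweighting and moving the atoms of an empirical distribution\<close>

lemma integral_weighted_dirac: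
  fixes h :: "'y::euclidean_space \<Rightarrow> real"
  assumes "h \<in> borel_measurable borel" and "p \<in> prob_vectors n"
  shows "(\<integral>y. h y \<partial>weighted_dirac n p ybar) = (\<Sum>i=1..n. p i * h (ybar i))"
  using assms unfolding weighted_dirac_def prob_vectors_def
  by (subst integral_distr) (auto simp: lebesgue_integral_point_measure_finite measurable_point_measure_eq1)

text \<open>A crude bound, whose purpose is boundedness above: it makes the real supremum over a set
  of weight vectors dominate each of its terms.\<close>

lemma prob_vectors_sum_sq_dev_le:
  assumes "p \<in> prob_vectors n" 
  shows "(\<Sum>i=1..n. (p i - 1 / real n)\<^sup>2) \<le> real n"
proof -
  have "(p i - 1 / real n)\<^sup>2 \<le> 1" if i: "i \<in> {1..n}" for i
  proof -
    have "p i \<le> (\<Sum>i=1..n. p i)"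
      using assms i by (intro member_le_sum) (auto simp: prob_vectors_def)
    then have "0 \<le> p i" "p i \<le> 1" "0 \<le> 1 / real n" "1 / real n \<le> 1"
      using assms i by (auto simp: prob_vectors_def)
    then have "\<bar>p i - 1 / real n\<bar> \<le> 1"
      by linarith
    then show ?thesis
      by (simp add: abs_square_le_1)
  qed
  then have "(\<Sum>i=1..n. (p i - 1 / real n)\<^sup>2) \<le> (\<Sum>i=1..n. 1)"
    by (rule sum_mono)
  then show ?thesis by simp
qed

lemma abs_sum_mult_le_sqrt:
  fixes f g :: "'i \<Rightarrow> real"
  shows "\<bar>\<Sum>i\<in>A. f i * g i\<bar> \<le> sqrt (\<Sum>i\<in>A. (f i)\<^sup>2) * sqrt (\<Sum>i\<in>A. (g i)\<^sup>2)"
  using order_trans[OF sum_abs[of "\<lambda>i. f i * g i" A, unfolded abs_mult] L2_set_mult_ineq]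
  unfolding L2_set_def .

text \<open>Cauchy-Schwarz against the constant 1.\<close>

lemma mean_le_root_mean_square:
  fixes b :: "nat \<Rightarrow> real"
  assumes "n \<ge> 1"
  shows "(\<Sum>i=1..n. b i) / real n \<le> sqrt ((\<Sum>i=1..n. (b i)\<^sup>2) / real n)"
proof -
  have "(\<Sum>i=1..n. b i) \<le> sqrt (real n) * sqrt (\<Sum>i=1..n. (b i)\<^sup>2)"
    using abs_sum_mult_le_sqrt[of "\<lambda>_. 1" b "{1..n}"] by simp
  then have "(\<Sum>i=1..n. b i) / real n \<le> sqrt (real n) * sqrt (\<Sum>i=1..n. (b i)\<^sup>2) / real n"
    by (rule divide_right_mono) simp
  also have "\<dots> = sqrt ((\<Sum>i=1..n. (b i)\<^sup>2) / real n)"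
    using assms by (simp add: real_sqrt_divide real_div_sqrt field_simps)
  finally show ?thesis .
qed

text \<open>Cauchy-Schwarz against the weights \<open>p i - 1 / n\<close>. The factor
  \<open>n\<close> is shifted to \<open>s\<close> so that the other factor is an empirical second
  moment; with \<open>s\<close> of order n^(-(1+r)), \<open>n * s\<close> is of order
  n^(-r).\<close>

lemma weighted_sum_minus_mean_le:
  fixes a :: "nat \<Rightarrow> real"
  assumes "n \<ge> 1" and s: "(\<Sum>i=1..n. (p i - 1 / real n)\<^sup>2) \<le> s"
  shows "\<bar>(\<Sum>i=1..n. p i * a i) - (\<Sum>i=1..n. a i) / real n\<bar>
      \<le> sqrt (real n * s) * sqrt ((\<Sum>i=1..n. (a i)\<^sup>2) / real n)"
proof -
  have "(\<Sum>i=1..n. p i * a i) - (\<Sum>i=1..n. a i) / real n = (\<Sum>i=1..n. (p i - 1 / real n) * a i)"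
    by (simp add: left_diff_distrib sum_subtractf sum_divide_distrib)
  also have "\<bar>\<dots>\<bar> \<le> sqrt (\<Sum>i=1..n. (p i - 1 / real n)\<^sup>2) * sqrt (\<Sum>i=1..n. (a i)\<^sup>2)"
    by (rule abs_sum_mult_le_sqrt)
  also have "\<dots> \<le> sqrt s * sqrt (\<Sum>i=1..n. (a i)\<^sup>2)"
    using s by (intro mult_right_mono) (auto simp: sum_nonneg)
  also have "\<dots> = sqrt (real n * s) * sqrt ((\<Sum>i=1..n. (a i)\<^sup>2) / real n)"
    using assms(1) by (simp add: real_sqrt_mult real_sqrt_divide)
  finally show ?thesis .
qed

text \<open>In the application \<open>e i\<close> is the true scenario at the given covariate,
  \<open>w i\<close> its estimate before projection, \<open>a\<close> the regression error at that
  covariate and \<open>b i\<close> the one at the i-th data point. The term with \<open>K\<close>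
  accounts for moving the atoms, the last term for changing the weights.\<close>

lemma weighted_cost_deviation:
  fixes S :: "'y::euclidean_space set" and h :: "'y \<Rightarrow> real"
  assumes n: "n \<ge> 1" and p: "p \<in> prob_vectors n"
    and s: "(\<Sum>i=1..n. (p i - 1 / real n)\<^sup>2) \<le> s"
    and S: "closed S" "convex S" "S \<noteq> {}"
    and lip: "K-lipschitz_on S h"
    and e: "\<And>i. i \<in> {1..n} \<Longrightarrow> e i \<in> S"
    and ybar: "\<And>i. i \<in> {1..n} \<Longrightarrow> ybar i \<in> proj_ball S (w i) \<rho>"
    and w: "\<And>i. i \<in> {1..n} \<Longrightarrow> norm (w i - e i) \<le> a + b i"
  shows "\<bar>(\<Sum>i=1..n. p i * h (ybar i)) - (\<Sum>i=1..n. h (e i)) / real n\<bar>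
      \<le> K * (\<rho> + a + (1 + sqrt (real n * s)) * sqrt ((\<Sum>i=1..n. (b i)\<^sup>2) / real n))
        + sqrt (real n * s) * sqrt ((\<Sum>i=1..n. (h (e i))\<^sup>2) / real n)"
proof -
  have p0: "\<And>i. p i \<ge> 0" and p1: "(\<Sum>i=1..n. p i) = 1"
    using p by (auto simp: prob_vectors_def)
  have K: "K \<ge> 0"
    using lip by (rule lipschitz_on_nonneg)
  have d: "\<bar>h (ybar i) - h (e i)\<bar> \<le> K * (\<rho> + a + b i)" if i: "i \<in> {1..n}" for i
  proof -
    \<comment> \<open>As \<open>e i\<close> lies in \<open>S\<close>, the projection fixes it, so
      projecting \<open>w i\<close> cannot increase its distance to \<open>e i\<close>.\<close>
    have "dist (closest_point S (w i)) (closest_point S (e i)) \<le> dist (w i) (e i)"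
      by (rule closest_point_lipschitz[OF S(2,1,3)])
    moreover have "closest_point S (e i) = e i"
      using e[OF i] by (rule closest_point_self)
    moreover have "dist (ybar i) (closest_point S (w i)) \<le> \<rho>" "ybar i \<in> S"
      using ybar[OF i] by (auto simp: proj_ball_def dist_norm)
    ultimately have "dist (ybar i) (e i) \<le> \<rho> + a + b i"
      using w[OF i] dist_triangle[of "ybar i" "e i" "closest_point S (w i)"] by (simp add: dist_norm)
    then have "K * dist (ybar i) (e i) \<le> K * (\<rho> + a + b i)"
      using K by (rule mult_left_mono)
    with lipschitz_onD[OF lip \<open>ybar i \<in> S\<close> e[OF i]] show ?thesis
      by (simp add: dist_real_def)
  qed
  have "\<bar>(\<Sum>i=1..n. p i * h (ybar i)) - (\<Sum>i=1..n. p i * h (e i))\<bar>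
      = \<bar>\<Sum>i=1..n. p i * (h (ybar i) - h (e i))\<bar>"
    by (simp add: right_diff_distrib sum_subtractf)
  also have "\<dots> \<le> (\<Sum>i=1..n. \<bar>p i * (h (ybar i) - h (e i))\<bar>)"
    by (rule sum_abs)
  also have "\<dots> \<le> (\<Sum>i=1..n. p i * (K * (\<rho> + a + b i)))"
    using d p0 by (intro sum_mono) (simp add: abs_mult mult_left_mono)
  also have "\<dots> = (\<Sum>i=1..n. p i * (K * (\<rho> + a)) + K * (p i * b i))"
    by (simp add: algebra_simps)
  also have "\<dots> = K * (\<rho> + a + (\<Sum>i=1..n. p i * b i))"
    using p1 by (simp add: sum.distrib distrib_left flip: sum_distrib_left sum_distrib_right)
  \<comment> \<open>The weighted mean of the errors is the plain mean, bounded by the root mean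
    square (the summand 1), plus the effect of the weights (the summand
    \<open>sqrt (n * s)\<close>).\<close>
  also have "(\<Sum>i=1..n. p i * b i) \<le> (1 + sqrt (real n * s)) * sqrt ((\<Sum>i=1..n. (b i)\<^sup>2) / real n)"
    using weighted_sum_minus_mean_le[OF n s, of b] mean_le_root_mean_square[OF n, of b]
    by (simp add: distrib_right)
  finally have "\<bar>(\<Sum>i=1..n. p i * h (ybar i)) - (\<Sum>i=1..n. p i * h (e i))\<bar>
      \<le> K * (\<rho> + a + (1 + sqrt (real n * s)) * sqrt ((\<Sum>i=1..n. (b i)\<^sup>2) / real n))"
    using K by (simp add: mult_left_mono)
  with weighted_sum_minus_mean_le[OF n s, of "\<lambda>i. h (e i)"] show ?thesis
    by linarith
qed

section \<open>Measurability, tightness and stochastic order\<close>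

lemma measurable_borel_of_metric_compose:
  assumes f: "f \<in> measurable M (borel_of_metric m)"
    and \<Phi>: "continuous_map (mtopology_of m) euclideanreal \<Phi>"
  shows "(\<lambda>\<omega>. \<Phi> (f \<omega>)) \<in> borel_measurable M"
proof (rule measurable_compose[OF f])
  \<comment> \<open>\<open>sigma\<close> yields the generated sigma-algebra only when the generators
    are subsets of the carrier.\<close>
  have sub: "{U. openin (mtopology_of m) U} \<subseteq> Pow (mspace m)"
    using openin_subset[of "mtopology_of m"] by auto
  have sp: "space (borel_of_metric m) = mspace m"
    by (simp add: borel_of_metric_def space_measure_of_conv)
  have op: "U \<in> sets (borel_of_metric m)" if "openin (mtopology_of m) U" for U
    using that sub by (simp add: borel_of_metric_def sigma_sets.Basic)
  show "\<Phi> \<in> borel_measurable (borel_of_metric m)"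
  proof (rule borel_measurableI)
    fix U :: "real set" assume "open U"
    then have "openin (mtopology_of m) {h \<in> topspace (mtopology_of m). \<Phi> h \<in> U}"
      by (intro openin_continuous_map_preimage[OF \<Phi>]) simp
    moreover have "\<Phi> -` U \<inter> space (borel_of_metric m) = {h \<in> topspace (mtopology_of m). \<Phi> h \<in> U}"
      by (auto simp: sp)
    ultimately show "\<Phi> -` U \<inter> space (borel_of_metric m) \<in> sets (borel_of_metric m)"
      by (simp add: op)
  qed
qed

text \<open>The exceptional event \<open>A\<close> may exceed the failure set of \<open>E n\<close>, so \<open>E n\<close> need not be measurable;
  this matters for statements uniform over the uncountable set of decisions.\<close>
definition with_prob :: "'w measure \<Rightarrow> real \<Rightarrow> (nat \<Rightarrow> 'w \<Rightarrow> bool) \<Rightarrow> bool" where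
  "with_prob M \<delta> E \<longleftrightarrow>
     (\<forall>\<^sub>F n in sequentially. \<exists>A\<in>sets M. measure M A \<le> \<delta> \<and> (\<forall>\<omega>\<in>space M - A. E n \<omega>))"

context prob_space
begin

lemma with_prob_conj:
  assumes "with_prob M \<delta> E" "with_prob M \<delta>' E'"
  shows "with_prob M (\<delta> + \<delta>') (\<lambda>n \<omega>. E n \<omega> \<and> E' n \<omega>)"
  using assms unfolding with_prob_def
proof (rule eventually_elim2)
  fix n
  assume "\<exists>A\<in>events. prob A \<le> \<delta> \<and> (\<forall>\<omega>\<in>space M - A. E n \<omega>)"
    and "\<exists>A\<in>events. prob A \<le> \<delta>' \<and> (\<forall>\<omega>\<in>space M - A. E' n \<omega>)"
  then obtain A A' where A: "A \<in> events" "prob A \<le> \<delta>" "\<And>\<omega>. \<omega> \<in> space M - A \<Longrightarrow> E n \<omega>"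
    and A': "A' \<in> events" "prob A' \<le> \<delta>'" "\<And>\<omega>. \<omega> \<in> space M - A' \<Longrightarrow> E' n \<omega>"
    by blast
  have "prob (A \<union> A') \<le> \<delta> + \<delta>'"
    using measure_Un_le[OF A(1) A'(1)] A(2) A'(2) by linarith
  with A A' show "\<exists>A\<in>events. prob A \<le> \<delta> + \<delta>' \<and> (\<forall>\<omega>\<in>space M - A. E n \<omega> \<and> E' n \<omega>)"
    by (intro bexI[of _ "A \<union> A'"]) auto
qed

text \<open>The null set where the implication fails is absorbed into the exceptional event without
  raising its probability. Thus deterministic bounds may be applied that hold only almost surely and
  only for large \<open>n\<close>.\<close>

lemma with_prob_AE_mono:
  assumes "with_prob M \<delta> E"
    and imp: "\<forall>\<^sub>F n in sequentially. AE \<omega> in M. E n \<omega> \<longrightarrow> E' n \<omega>"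
  shows "with_prob M \<delta> E'"
  using assms unfolding with_prob_def
proof (rule eventually_elim2)
  fix n
  assume "\<exists>A\<in>events. prob A \<le> \<delta> \<and> (\<forall>\<omega>\<in>space M - A. E n \<omega>)"
    and AE: "AE \<omega> in M. E n \<omega> \<longrightarrow> E' n \<omega>"
  then obtain A where A: "A \<in> events" "prob A \<le> \<delta>" "\<And>\<omega>. \<omega> \<in> space M - A \<Longrightarrow> E n \<omega>"
    by auto
  obtain B where B: "{\<omega> \<in> space M. \<not> (E n \<omega> \<longrightarrow> E' n \<omega>)} \<subseteq> B" "B \<in> null_sets M"
    using AE_E[OF AE] by (metis (no_types, lifting) null_setsI)
  have "prob (A \<union> B) \<le> \<delta>"
    using A B by (simp add: measure_Un_null_set)
  with A B show "\<exists>A\<in>events. prob A \<le> \<delta> \<and> (\<forall>\<omega>\<in>space M - A. E' n \<omega>)"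
    by (intro bexI[of _ "A \<union> B"]) auto
qed

text \<open>A single real random variable is tight: the events decrease to the empty set, so
  continuity from above applies.\<close>

lemma eventually_prob_abs_gt_le:
  fixes R :: "'a \<Rightarrow> real"
  assumes R: "R \<in> borel_measurable M" and "\<delta> > 0"
  shows "\<forall>\<^sub>F k in sequentially. prob {\<omega>\<in>space M. \<bar>R \<omega>\<bar> > real k} \<le> \<delta>"
proof -
  have "(\<lambda>k. prob {\<omega>\<in>space M. \<bar>R \<omega>\<bar> > real k}) \<longlonglongrightarrow> prob (\<Inter>k. {\<omega>\<in>space M. \<bar>R \<omega>\<bar> > real k})"
    using R by (intro finite_Lim_measure_decseq) (auto simp: decseq_def)
  also have "(\<Inter>k. {\<omega>\<in>space M. \<bar>R \<omega>\<bar> > real k}) = {}"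
    using real_arch_simple by (auto simp flip: not_le)
  finally have "\<forall>\<^sub>F k in sequentially. prob {\<omega>\<in>space M. \<bar>R \<omega>\<bar> > real k} < \<delta>"
    using \<open>\<delta> > 0\<close> by (auto dest: order_tendstoD(2))
  then show ?thesis
    by (rule eventually_mono) simp
qed

text \<open>\<open>with_prob\<close> speaks of large \<open>n\<close> only, boundedness in
  probability of all \<open>n \<ge> 1\<close>. The finitely many remaining variables are tight one
  by one, and a common bound serves them all.\<close>

lemma bounded_in_probI:
  assumes R: "\<And>n. n \<ge> 1 \<Longrightarrow> R n \<in> borel_measurable M"
    and tight: "\<And>\<delta>. \<delta> > 0 \<Longrightarrow> \<exists>K. with_prob M \<delta> (\<lambda>n \<omega>. \<bar>R n \<omega>\<bar> \<le> K)"
  shows "bounded_in_prob M R"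
  unfolding bounded_in_prob_def
proof (intro conjI allI impI)
  fix \<delta> :: real assume \<delta>: "\<delta> > 0"
  obtain K N where K: "\<And>n. n \<ge> N \<Longrightarrow>
      \<exists>A\<in>events. prob A \<le> \<delta> \<and> (\<forall>\<omega>\<in>space M - A. \<bar>R n \<omega>\<bar> \<le> K)"
    using tight[OF \<delta>] unfolding with_prob_def eventually_sequentially by blast
  have "\<forall>n\<in>{1..<N}. \<forall>\<^sub>F k in sequentially. prob {\<omega>\<in>space M. \<bar>R n \<omega>\<bar> > real k} \<le> \<delta>"
    using R \<delta> by (auto intro: eventually_prob_abs_gt_le)
  then have "\<forall>\<^sub>F k in sequentially. \<forall>n\<in>{1..<N}. prob {\<omega>\<in>space M. \<bar>R n \<omega>\<bar> > real k} \<le> \<delta>"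
    by (simp add: eventually_ball_finite_distrib)
  moreover have "\<forall>\<^sub>F k in sequentially. K \<le> real k"
    using filterlim_real_sequentially by (auto simp: filterlim_at_top)
  ultimately have "\<exists>k. (\<forall>n\<in>{1..<N}. prob {\<omega>\<in>space M. \<bar>R n \<omega>\<bar> > real k} \<le> \<delta>) \<and> K \<le> real k"
    by (intro eventually_happens'[OF sequentially_bot] eventually_conj)
  then obtain k where k: "\<And>n. n \<in> {1..<N} \<Longrightarrow> prob {\<omega>\<in>space M. \<bar>R n \<omega>\<bar> > real k} \<le> \<delta>" "K \<le> real k"
    by blast
  have "prob {\<omega>\<in>space M. \<bar>R n \<omega>\<bar> > real k} \<le> \<delta>" if "n \<ge> 1" for n
  proof (cases "n \<ge> N")
    case True
    then obtain A where A: "A \<in> events" "prob A \<le> \<delta>" "\<And>\<omega>. \<omega>\<in>space M - A \<Longrightarrow> \<bar>R n \<omega>\<bar> \<le> K"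
      using K by blast
    have "{\<omega>\<in>space M. \<bar>R n \<omega>\<bar> > real k} \<subseteq> A"
      using A(3) k(2) by force
    then show ?thesis
      using A(2) by (rule order_trans[OF finite_measure_mono[OF _ A(1)]])
  next
    case False
    with that show ?thesis
      by (intro k(1)) simp
  qed
  then show "\<exists>K. \<forall>n\<ge>1. prob {\<omega>\<in>space M. \<bar>R n \<omega>\<bar> > K} \<le> \<delta>"
    by blast
qed (rule R)

lemma bounded_in_probD:
  assumes "bounded_in_prob M R" "\<delta> > 0"
  shows "\<exists>K>0. with_prob M \<delta> (\<lambda>n \<omega>. \<bar>R n \<omega>\<bar> \<le> K)"
proof -
  obtain K where K: "\<And>n. n \<ge> 1 \<Longrightarrow> prob {\<omega>\<in>space M. \<bar>R n \<omega>\<bar> > K} \<le> \<delta>"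
    using assms unfolding bounded_in_prob_def by blast
  have "with_prob M \<delta> (\<lambda>n \<omega>. \<bar>R n \<omega>\<bar> \<le> max K 1)"
    unfolding with_prob_def eventually_sequentially
  proof (intro exI[of _ 1] allI impI)
    fix n :: nat assume n: "1 \<le> n"
    then have "R n \<in> borel_measurable M"
      using assms by (auto simp: bounded_in_prob_def)
    then have "{\<omega>\<in>space M. \<bar>R n \<omega>\<bar> > K} \<in> events"
      by measurable
    then show "\<exists>A\<in>events. prob A \<le> \<delta> \<and> (\<forall>\<omega>\<in>space M - A. \<bar>R n \<omega>\<bar> \<le> max K 1)"
      using K[OF n] by (intro bexI[of _ "{\<omega>\<in>space M. \<bar>R n \<omega>\<bar> > K}"]) auto
  qed
  then show ?thesis
    by (intro exI[of _ "max K 1"]) auto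
qed

text \<open>The bounded factor is the quotient \<open>V n \<omega> / W n\<close>, which positivity
  of \<open>W n\<close> makes meaningful.\<close>

lemma stoch_bigoI:
  assumes V: "\<And>n. n \<ge> 1 \<Longrightarrow> V n \<in> borel_measurable M"
    and W: "\<And>n. n \<ge> 1 \<Longrightarrow> W n > 0"
    and tight: "\<And>\<delta>. \<delta> > 0 \<Longrightarrow> \<exists>K. with_prob M \<delta> (\<lambda>n \<omega>. \<bar>V n \<omega>\<bar> \<le> K * W n)"
  shows "stoch_bigo M V W"
  unfolding stoch_bigo_def
proof (intro exI[of _ "\<lambda>n \<omega>. V n \<omega> / W n"] conjI bounded_in_probI)
  fix \<delta> :: real assume "\<delta> > 0"
  then obtain K where K: "with_prob M \<delta> (\<lambda>n \<omega>. \<bar>V n \<omega>\<bar> \<le> K * W n)"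
    using tight by blast
  have "with_prob M \<delta> (\<lambda>n \<omega>. \<bar>V n \<omega> / W n\<bar> \<le> K)"
  proof (rule with_prob_AE_mono[OF K])
    show "\<forall>\<^sub>F n in sequentially. AE \<omega> in M. \<bar>V n \<omega>\<bar> \<le> K * W n \<longrightarrow> \<bar>V n \<omega> / W n\<bar> \<le> K"
      using eventually_ge_at_top[of 1]
    proof eventually_elim
      fix n :: nat assume "1 \<le> n"
      then have "W n > 0" by (rule W)
      then show "AE \<omega> in M. \<bar>V n \<omega>\<bar> \<le> K * W n \<longrightarrow> \<bar>V n \<omega> / W n\<bar> \<le> K"
        by (intro AE_I2) (simp add: pos_divide_le_eq)
    qed
  qed
  then show "\<exists>K. with_prob M \<delta> (\<lambda>n \<omega>. \<bar>V n \<omega> / W n\<bar> \<le> K)"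
    by blast
next
  fix n :: nat assume "n \<ge> 1"
  then show "(\<lambda>\<omega>. V n \<omega> / W n) \<in> borel_measurable M"
    using V by (intro borel_measurable_divide) simp_all
next
  have "W n \<noteq> 0" if "n \<ge> 1" for n
    using W[OF that] by simp
  then show "\<forall>n\<ge>1. \<forall>\<omega>\<in>space M. V n \<omega> = V n \<omega> / W n * W n"
    by simp
qed

lemma stoch_bigoD:
  assumes "stoch_bigo M V W" "\<delta> > 0"
  shows "\<exists>K>0. with_prob M \<delta> (\<lambda>n \<omega>. \<bar>V n \<omega>\<bar> \<le> K * \<bar>W n\<bar>)"
proof -
  obtain R where R: "bounded_in_prob M R" "\<And>n \<omega>. n \<ge> 1 \<Longrightarrow> \<omega> \<in> space M \<Longrightarrow> V n \<omega> = R n \<omega> * W n"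
    using assms by (auto simp: stoch_bigo_def)
  obtain K where K: "K > 0" "with_prob M \<delta> (\<lambda>n \<omega>. \<bar>R n \<omega>\<bar> \<le> K)"
    using bounded_in_probD[OF R(1) assms(2)] by blast
  have "with_prob M \<delta> (\<lambda>n \<omega>. \<bar>V n \<omega>\<bar> \<le> K * \<bar>W n\<bar>)"
  proof (rule with_prob_AE_mono[OF K(2)])
    show "\<forall>\<^sub>F n in sequentially. AE \<omega> in M. \<bar>R n \<omega>\<bar> \<le> K \<longrightarrow> \<bar>V n \<omega>\<bar> \<le> K * \<bar>W n\<bar>"
      using eventually_ge_at_top[of 1]
      by eventually_elim (auto simp: R(2) abs_mult intro!: AE_I2 mult_right_mono)
  qed
  with K(1) show ?thesis
    by (intro exI[of _ K] conjI)
qed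

lemma tendsto_0_in_probD:
  assumes S: "tendsto_0_in_prob M S" and "\<delta> > 0" "\<eta> > 0"
  shows "with_prob M \<delta> (\<lambda>n \<omega>. S n \<omega> \<le> ereal \<eta>)"
proof -
  have "\<forall>\<^sub>F n in sequentially. prob {\<omega>\<in>space M. S n \<omega> > ereal \<eta>} < \<delta>"
    using assms by (auto simp: tendsto_0_in_prob_def dest: order_tendstoD(2))
  then show ?thesis
    unfolding with_prob_def using eventually_ge_at_top[of 1]
  proof eventually_elim
    fix n :: nat assume n: "prob {\<omega>\<in>space M. S n \<omega> > ereal \<eta>} < \<delta>" "1 \<le> n"
    then have "S n \<in> borel_measurable M"
      using S by (auto simp: tendsto_0_in_prob_def)
    then have "{\<omega>\<in>space M. S n \<omega> > ereal \<eta>} \<in> events"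
      by measurable
    with n show "\<exists>A\<in>events. prob A \<le> \<delta> \<and> (\<forall>\<omega>\<in>space M - A. S n \<omega> \<le> ereal \<eta>)"
      by (intro bexI[of _ "{\<omega>\<in>space M. S n \<omega> > ereal \<eta>}"]) auto
  qed
qed

text \<open>Choose \<open>k\<close> such that the limit rarely lies farther than \<open>k\<close>
  from \<open>a\<close>, measured by a bounded continuous test function; convergence of its
  expectation carries this over to \<open>W n\<close> for large \<open>n\<close>.\<close>

lemma conv_in_distribution_imp_tight:
  assumes conv: "conv_in_distribution m M W N V" and N: "prob_space N"
    and V: "V \<in> measurable N (borel_of_metric m)"
    and a: "a \<in> mspace m"
    and Wm: "\<And>n. n \<ge> 1 \<Longrightarrow> (\<lambda>\<omega>. mdist m a (W n \<omega>)) \<in> borel_measurable M"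
    and "\<delta> > 0"
  shows "\<exists>K>0. with_prob M \<delta> (\<lambda>n \<omega>. mdist m a (W n \<omega>) \<le> K)"
proof -
  interpret N: prob_space N by (rule N)
  have cont: "continuous_map (mtopology_of m) euclideanreal (mdist m a)"
    using a by (intro continuous_map_mdist) auto
  \<comment> \<open>A continuous ramp, 0 up to distance \<open>k\<close> and 1 from distance
    \<open>k + 1\<close> on. It dominates the indicator of distances above \<open>k + 1\<close>, and
    it tends to 0 pointwise as \<open>k\<close> grows.\<close>
  define \<Phi> where "\<Phi> = (\<lambda>k h. min 1 (max 0 (mdist m a h - real k)))"
  have \<Phi>c: "continuous_map (mtopology_of m) euclideanreal (\<Phi> k)" for k
    unfolding \<Phi>_def using a by (intro continuous_intros) auto
  have \<Phi>b: "0 \<le> \<Phi> k h" "\<Phi> k h \<le> 1" for k h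
    by (auto simp: \<Phi>_def)
  have "bounded (\<Phi> k ` A)" for k A
    using \<Phi>b by (intro boundedI[of _ 1]) auto
  then have lim: "(\<lambda>n. \<integral>\<omega>. \<Phi> k (W n \<omega>) \<partial>M) \<longlonglongrightarrow> (\<integral>\<omega>. \<Phi> k (V \<omega>) \<partial>N)" for k
    using conv \<Phi>c by (simp add: conv_in_distribution_def)
  have "(\<lambda>k. \<integral>\<omega>. \<Phi> k (V \<omega>) \<partial>N) \<longlonglongrightarrow> (\<integral>\<omega>. 0 \<partial>N)"
  proof (rule integral_dominated_convergence[where w = "\<lambda>_. 1"])
    show "(\<lambda>\<omega>. \<Phi> k (V \<omega>)) \<in> borel_measurable N" for k
      by (rule measurable_borel_of_metric_compose[OF V \<Phi>c])
    show "AE \<omega> in N. (\<lambda>k. \<Phi> k (V \<omega>)) \<longlonglongrightarrow> 0"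
    proof (intro AE_I2 tendsto_eventually)
      fix \<omega>
      have "\<forall>\<^sub>F k in sequentially. mdist m a (V \<omega>) \<le> real k"
        using filterlim_real_sequentially by (auto simp: filterlim_at_top)
      then show "\<forall>\<^sub>F k in sequentially. \<Phi> k (V \<omega>) = 0"
        by eventually_elim (simp add: \<Phi>_def)
    qed
  qed (use \<Phi>b in \<open>auto intro!: AE_I2\<close>)
  then have "\<forall>\<^sub>F k in sequentially. (\<integral>\<omega>. \<Phi> k (V \<omega>) \<partial>N) < \<delta>"
    using \<open>\<delta> > 0\<close> by (auto dest: order_tendstoD(2))
  then obtain k where k: "(\<integral>\<omega>. \<Phi> k (V \<omega>) \<partial>N) < \<delta>"
    by (auto simp: eventually_sequentially)
  have "with_prob M \<delta> (\<lambda>n \<omega>. mdist m a (W n \<omega>) \<le> real k + 1)"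
    unfolding with_prob_def using order_tendstoD(2)[OF lim k] eventually_ge_at_top[of 1]
  proof eventually_elim
    fix n :: nat assume n: "(\<integral>\<omega>. \<Phi> k (W n \<omega>) \<partial>M) < \<delta>" "1 \<le> n"
    note [measurable] = Wm[OF n(2)]
    define A where "A = {\<omega>\<in>space M. mdist m a (W n \<omega>) > real k + 1}"
    have A [measurable]: "A \<in> events"
      unfolding A_def by measurable
    have "prob A = (\<integral>\<omega>. indicator A \<omega> \<partial>M)"
      using A by simp
    also have "\<dots> \<le> (\<integral>\<omega>. \<Phi> k (W n \<omega>) \<partial>M)"
    proof (rule integral_mono)
      show "integrable M (\<lambda>\<omega>. \<Phi> k (W n \<omega>))"
        unfolding \<Phi>_def by (rule integrable_const_bound[of _ 1]) auto
      show "indicator A \<omega> \<le> \<Phi> k (W n \<omega>)" for \<omega>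
        by (auto simp: A_def \<Phi>_def indicator_def)
    qed (rule integrable_const_bound[of _ 1]; simp)
    finally show "\<exists>A\<in>events. prob A \<le> \<delta> \<and> (\<forall>\<omega>\<in>space M - A. mdist m a (W n \<omega>) \<le> real k + 1)"
      using n A by (intro bexI[of _ A]) (auto simp: A_def)
  qed
  then show ?thesis
    by (intro exI[of _ "real k + 1"]) auto
qed

end

section \<open>The supremum metric on continuous functions\<close>

lemma mspace_C_space:
  assumes "compact S"
  shows "mspace (C_space S) = {f. f \<in> extensional S \<and> continuous_on S f}"
  using assms unfolding C_space_def
  by (subst compactin_mspace_cfunspace) (auto simp: compactin_subtopology)

lemma mdist_C_space_le:
  assumes "f \<in> mspace (C_space S)" "g \<in> mspace (C_space S)" "S \<noteq> {}"
  shows "mdist (C_space S) f g \<le> a \<longleftrightarrow> (\<forall>z\<in>S. \<bar>f z - g z\<bar> \<le> a)"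
  using assms unfolding C_space_def by (subst cfunspace_mdist_le) (auto simp: dist_real_def)

text \<open>Both sides have the same upper bounds, hence are equal. The right side exhibits the norm
  of a scaled difference as a continuous function of \<open>f\<close>, from which measurability
  follows when \<open>f\<close> is a random element.\<close>

lemma mdist_C_space_scaled_diff:
  fixes f g :: "'a::topological_space \<Rightarrow> real"
  assumes S: "compact S" "S \<noteq> {}" and f: "f \<in> mspace (C_space S)" and g: "g \<in> mspace (C_space S)"
    and "t > 0"
  shows "mdist (C_space S) (\<lambda>z\<in>S. 0) (\<lambda>z\<in>S. t * (f z - g z)) = t * mdist (C_space S) f g"
proof -
  have "continuous_on S (\<lambda>z. t * (f z - g z))"
    using f g S by (auto simp: mspace_C_space intro!: continuous_intros)
  then have "(\<lambda>z\<in>S. t * (f z - g z)) \<in> mspace (C_space S)" "(\<lambda>z\<in>S. 0) \<in> mspace (C_space S)"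
    using S by (auto simp: mspace_C_space cong: continuous_on_cong)
  then have "mdist (C_space S) (\<lambda>z\<in>S. 0) (\<lambda>z\<in>S. t * (f z - g z)) \<le> a
      \<longleftrightarrow> (\<forall>z\<in>S. \<bar>f z - g z\<bar> \<le> a / t)" for a
    using \<open>t > 0\<close> S by (simp add: mdist_C_space_le abs_mult pos_le_divide_eq mult.commute)
  also have "(\<forall>z\<in>S. \<bar>f z - g z\<bar> \<le> a / t) \<longleftrightarrow> t * mdist (C_space S) f g \<le> a" for a
    unfolding mdist_C_space_le[OF f g S(2), of "a / t", symmetric]
    using \<open>t > 0\<close> by (simp add: pos_le_divide_eq mult.commute)
  finally have eq: "mdist (C_space S) (\<lambda>z\<in>S. 0) (\<lambda>z\<in>S. t * (f z - g z)) \<le> a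
      \<longleftrightarrow> t * mdist (C_space S) f g \<le> a" for a .
  show ?thesis
    using eq[THEN iffD1, OF order_refl] eq[THEN iffD2, OF order_refl] by (rule order_antisym[rotated])
qed

section \<open>Worst-case expectation over the ambiguity set\<close>

text \<open>Here \<open>t\<close> stands for the rate n^(-r/2), against which every input is
  measured. The bound holds for each distribution in the set with the same constant, and so survives
  the supremum over this nonempty set.\<close>

lemma ambiguity_sup_deviation:
  fixes S :: "'y::euclidean_space set" and h :: "'y \<Rightarrow> real" and b :: "nat \<Rightarrow> real"
  assumes n: "n \<ge> 1" and PP: "PP \<subseteq> prob_vectors n"
    and ne: "ambiguity_set n PP (\<lambda>i. proj_ball S (w i) \<rho>) \<noteq> {}"
    and S: "closed S" "convex S" "S \<noteq> {}"
    and h: "h \<in> borel_measurable borel" "K-lipschitz_on S h"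
    and e: "\<And>i. i \<in> {1..n} \<Longrightarrow> e i \<in> S"
    and w: "\<And>i. i \<in> {1..n} \<Longrightarrow> norm (w i - e i) \<le> a + b i"
    and t: "0 < t" "t \<le> 1"
    and s: "real n * (SUP p\<in>PP. \<Sum>i=1..n. (p i - 1 / real n)\<^sup>2) \<le> C\<^sub>s * t\<^sup>2"
    and \<rho>: "\<rho> \<le> C\<^sub>\<rho> * t"
    and a: "a\<^sup>2 \<le> A * t\<^sup>2"
    and b: "(\<Sum>i=1..n. (b i)\<^sup>2) / real n \<le> B * t\<^sup>2"
    and H: "(\<Sum>i=1..n. (h (e i))\<^sup>2) / real n \<le> H"
  shows "\<bar>(SUP Q\<in>ambiguity_set n PP (\<lambda>i. proj_ball S (w i) \<rho>). \<integral>y. h y \<partial>Q) - (\<Sum>i=1..n. h (e i)) / real n\<bar>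
      \<le> (K * (C\<^sub>\<rho> + sqrt A + (1 + sqrt C\<^sub>s) * sqrt B) + sqrt C\<^sub>s * sqrt H) * t"
proof (rule cSup_asclose[OF _ ballI])
  define s where "s = (SUP p\<in>PP. \<Sum>i=1..n. (p i - 1 / real n)\<^sup>2)"
  have K: "K \<ge> 0"
    using h(2) by (rule lipschitz_on_nonneg)
  have sqrt_le: "sqrt u \<le> sqrt v * t" if "u \<le> v * t\<^sup>2" for u v
    using real_sqrt_le_mono[OF that] t by (simp add: real_sqrt_mult)
  have a': "a \<le> sqrt A * t"
    using sqrt_le[OF a] by simp
  have b': "sqrt ((\<Sum>i=1..n. (b i)\<^sup>2) / real n) \<le> sqrt B * t"
    by (rule sqrt_le[OF b])
  have s': "sqrt (real n * s) \<le> sqrt C\<^sub>s * t"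
    using sqrt_le[OF s] by (simp add: s_def)
  have "bdd_above ((\<lambda>p. \<Sum>i=1..n. (p i - 1 / real n)\<^sup>2) ` PP)"
    using PP by (intro bdd_aboveI2[where M = "real n"] prob_vectors_sum_sq_dev_le) auto
  then have s_upper: "(\<Sum>i=1..n. (p i - 1 / real n)\<^sup>2) \<le> s" if "p \<in> PP" for p
    unfolding s_def using that by (intro cSUP_upper)
  have "PP \<noteq> {}"
    using ne by (auto simp: ambiguity_set_def)
  then obtain p0 where "p0 \<in> PP"
    by auto
  then have s0: "s \<ge> 0"
    by (intro order_trans[OF _ s_upper]) (simp_all add: sum_nonneg)
  \<comment> \<open>Nonnegativity of \<open>s\<close> forces \<open>C\<^sub>s \<ge> 0\<close>;
    together with \<open>t \<le> 1\<close> this allows a factor \<open>t\<close> to be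
    dropped.\<close>
  then have "C\<^sub>s * t\<^sup>2 \<ge> 0"
    using s by (intro order_trans[OF _ s]) (simp add: s_def)
  then have "sqrt C\<^sub>s * t \<le> sqrt C\<^sub>s"
    using t by (intro mult_left_le) (auto simp: zero_le_mult_iff)
  have m0: "0 \<le> (\<Sum>i=1..n. (b i)\<^sup>2) / real n" "0 \<le> (\<Sum>i=1..n. (h (e i))\<^sup>2) / real n"
    by (simp_all add: sum_nonneg)
  \<comment> \<open>This product contains a term of order \<open>t\<^sup>2\<close>; bounding its
    weight factor by a constant leaves the single power of \<open>t\<close> that is wanted.\<close>
  have q: "(1 + sqrt (real n * s)) * sqrt ((\<Sum>i=1..n. (b i)\<^sup>2) / real n) \<le> (1 + sqrt C\<^sub>s) * (sqrt B * t)"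
  proof (rule mult_mono)
    show "1 + sqrt (real n * s) \<le> 1 + sqrt C\<^sub>s"
      using s' \<open>sqrt C\<^sub>s * t \<le> sqrt C\<^sub>s\<close> by linarith
    then show "0 \<le> 1 + sqrt C\<^sub>s"
      using s0 by (intro order_trans[OF _ \<open>1 + sqrt (real n * s) \<le> 1 + sqrt C\<^sub>s\<close>]) simp
  qed (use b' m0 in simp_all)
  fix v assume "v \<in> (\<lambda>Q. \<integral>y. h y \<partial>Q) ` ambiguity_set n PP (\<lambda>i. proj_ball S (w i) \<rho>)"
  then obtain p ybar where p: "p \<in> PP" and ybar: "\<And>i. i \<in> {1..n} \<Longrightarrow> ybar i \<in> proj_ball S (w i) \<rho>"
    and v: "v = (\<integral>y. h y \<partial>weighted_dirac n p ybar)"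
    unfolding ambiguity_set_def by blast
  have pv: "p \<in> prob_vectors n"
    using p PP by auto
  have "\<bar>v - (\<Sum>i=1..n. h (e i)) / real n\<bar>
      \<le> K * (\<rho> + a + (1 + sqrt (real n * s)) * sqrt ((\<Sum>i=1..n. (b i)\<^sup>2) / real n))
        + sqrt (real n * s) * sqrt ((\<Sum>i=1..n. (h (e i))\<^sup>2) / real n)"
    unfolding v integral_weighted_dirac[OF h(1) pv]
    by (rule weighted_cost_deviation[OF n pv s_upper[OF p] S h(2) e ybar w])
  also have "\<dots> \<le> K * (C\<^sub>\<rho> * t + sqrt A * t + (1 + sqrt C\<^sub>s) * (sqrt B * t)) + (sqrt C\<^sub>s * t) * sqrt H"
  proof (rule add_mono)
    have "\<rho> + a + (1 + sqrt (real n * s)) * sqrt ((\<Sum>i=1..n. (b i)\<^sup>2) / real n)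
        \<le> C\<^sub>\<rho> * t + sqrt A * t + (1 + sqrt C\<^sub>s) * (sqrt B * t)"
      using \<rho> a' q by linarith
    then show "K * (\<rho> + a + (1 + sqrt (real n * s)) * sqrt ((\<Sum>i=1..n. (b i)\<^sup>2) / real n))
        \<le> K * (C\<^sub>\<rho> * t + sqrt A * t + (1 + sqrt C\<^sub>s) * (sqrt B * t))"
      using K by (rule mult_left_mono)
    have "0 \<le> sqrt (real n * s)"
      using s0 by simp
    then have "0 \<le> sqrt C\<^sub>s * t"
      using s' by linarith
    then show "sqrt (real n * s) * sqrt ((\<Sum>i=1..n. (h (e i))\<^sup>2) / real n) \<le> (sqrt C\<^sub>s * t) * sqrt H"
      using s' H m0 by (intro mult_mono) auto
  qed
  finally show "\<bar>v - (\<Sum>i=1..n. h (e i)) / real n\<bar>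
      \<le> (K * (C\<^sub>\<rho> + sqrt A + (1 + sqrt C\<^sub>s) * sqrt B) + sqrt C\<^sub>s * sqrt H) * t"
    by (simp add: algebra_simps)
qed (use ne in simp)

section \<open>Minimization under a uniform perturbation\<close>

text \<open>Each lower bound of one function, lowered by \<open>B\<close>, bounds the other. The
  first conclusion makes the real infimum of \<open>f\<close> a genuine one, as the second
  comparison requires.\<close>

lemma abs_INF_diff_le:
  fixes f g :: "'a \<Rightarrow> real"
  assumes "S \<noteq> {}" and bdd: "bdd_below (g ` S)" and d: "\<And>z. z \<in> S \<Longrightarrow> \<bar>f z - g z\<bar> \<le> B"
  shows "bdd_below (f ` S)" and "\<bar>(INF z\<in>S. f z) - (INF z\<in>S. g z)\<bar> \<le> B"
proof -
  have lower: "(INF z\<in>S. g z) - B \<le> f z" if "z \<in> S" for z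
    using cINF_lower[OF bdd that] d[OF that] by linarith
  then show bdd': "bdd_below (f ` S)"
    by (rule bdd_belowI2)
  have "(INF z\<in>S. g z) - B \<le> (INF z\<in>S. f z)"
    using assms(1) lower by (rule cINF_greatest)
  moreover have "(INF z\<in>S. f z) - B \<le> (INF z\<in>S. g z)"
  proof (rule cINF_greatest[OF assms(1)])
    fix z assume "z \<in> S"
    then show "(INF z\<in>S. f z) - B \<le> g z"
      using cINF_lower[OF bdd'] d[of z] by fastforce
  qed
  ultimately show "\<bar>(INF z\<in>S. f z) - (INF z\<in>S. g z)\<bar> \<le> B"
    by linarith
qed

text \<open>One \<open>B\<close> is lost in passing from \<open>g\<close> to \<open>f\<close> at the
  minimizer, another in comparing the two infima.\<close>

lemma is_arg_min_perturbed_gap: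
  fixes f g :: "'a \<Rightarrow> real"
  assumes zh: "is_arg_min f (\<lambda>z. z \<in> S) zh" and bdd: "bdd_below (g ` S)"
    and d: "\<And>z. z \<in> S \<Longrightarrow> \<bar>f z - g z\<bar> \<le> B"
  shows "\<bar>g zh - (INF z\<in>S. g z)\<bar> \<le> 2 * B"
proof -
  have zhS: "zh \<in> S" and min: "\<And>z. z \<in> S \<Longrightarrow> f zh \<le> f z"
    using zh by (auto simp: is_arg_min_def not_less)
  have "f zh \<le> (INF z\<in>S. f z)"
    by (rule cINF_greatest[OF _ min]) (use zhS in blast)
  moreover have "\<bar>(INF z\<in>S. f z) - (INF z\<in>S. g z)\<bar> \<le> B"
    by (rule abs_INF_diff_le(2)[OF _ bdd d]) (use zhS in blast)
  moreover have "(INF z\<in>S. g z) \<le> g zh"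
    by (rule cINF_lower[OF bdd zhS])
  ultimately show ?thesis
    using d[OF zhS] by linarith
qed

section \<open>Rates for the robust optimal value and for the true cost of a robust decision\<close>

theorem theorem17:
  fixes M :: "'w measure"
    and X :: "'w \<Rightarrow> 'x::euclidean_space" and Y :: "'w \<Rightarrow> 'y::euclidean_space"
    and xd :: "nat \<Rightarrow> 'w \<Rightarrow> 'x" and yd :: "nat \<Rightarrow> 'w \<Rightarrow> 'y"
    and fstar :: "'x \<Rightarrow> 'y"
    and \<Z> :: "'z::euclidean_space set" and c :: "'z \<Rightarrow> 'y \<Rightarrow> real"
    and reg :: "nat \<Rightarrow> (nat \<Rightarrow> 'y \<times> 'x) \<Rightarrow> 'x \<Rightarrow> 'y"
    and \<PP> :: "nat \<Rightarrow> 'x \<Rightarrow> real \<Rightarrow> (nat \<Rightarrow> real) set"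
    and \<mu> \<zeta> :: "nat \<Rightarrow> 'x \<Rightarrow> real"
    and L :: "'z \<Rightarrow> real" and r :: real
    and N :: "'v measure" and V :: "'x \<Rightarrow> 'v \<Rightarrow> 'z \<Rightarrow> real"
  defines "\<epsilon> \<equiv> \<lambda>\<omega>. Y \<omega> - fstar (X \<omega>)"
    and "\<epsilon>d \<equiv> \<lambda>i \<omega>. yd i \<omega> - fstar (xd i \<omega>)"
    and "PX \<equiv> distr M borel X"
    and "\<X> \<equiv> dist_support (distr M borel X)"
    and "\<Y> \<equiv> dist_support (distr M borel Y)"
  defines "g \<equiv> \<lambda>z x. \<integral>\<omega>. c z (fstar x + \<epsilon> \<omega>) \<partial>M"
  defines "vstar \<equiv> \<lambda>x. INF z\<in>\<Z>. g z x"
    and "gn \<equiv> \<lambda>n z x \<omega>. (\<Sum>i=1..n. c z (fstar x + \<epsilon>d i \<omega>)) / real n"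
    and "fhat \<equiv> \<lambda>n \<omega>. reg n (\<lambda>i\<in>{1..n}. (yd i \<omega>, xd i \<omega>))"
  defines "\<epsilon>hat \<equiv> \<lambda>n i \<omega>. yd i \<omega> - fhat n \<omega> (xd i \<omega>)"
  defines "\<P>hat \<equiv> \<lambda>n x \<omega>. ambiguity_set n (\<PP> n x (\<zeta> n x))
                       (\<lambda>i. proj_ball \<Y> (fhat n \<omega> x + \<epsilon>hat n i \<omega>) (\<mu> n x))"
  defines "obj \<equiv> \<lambda>n x \<omega> z. SUP Q\<in>\<P>hat n x \<omega>. \<integral>y. c z y \<partial>Q"
  defines "vdro \<equiv> \<lambda>n x \<omega>. INF z\<in>\<Z>. obj n x \<omega> z"
  \<comment> \<open>population and error model\<close>
  assumes "prob_space M"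
    and "X \<in> borel_measurable M" "Y \<in> borel_measurable M"
    and "\<Y> \<noteq> {}" "convex \<Y>"
    and "regression_function M X Y fstar"
    and "prob_space.indep_set M (sets (vimage_algebra (space M) \<epsilon> borel))
           (sets (vimage_algebra (space M) X borel))"
    and "(\<integral>\<omega>. \<epsilon> \<omega> \<partial>M) = 0"
  \<comment> \<open>data and regression method\<close>
    and "\<And>i. i \<ge> 1 \<Longrightarrow> xd i \<in> borel_measurable M"
    and "\<And>i. i \<ge> 1 \<Longrightarrow> yd i \<in> borel_measurable M"
    and "\<And>i. i \<ge> 1 \<Longrightarrow> distr M borel (\<lambda>\<omega>. (yd i \<omega>, xd i \<omega>)) = distr M borel (\<lambda>\<omega>. (Y \<omega>, X \<omega>))"
    and "\<And>n. n \<ge> 1 \<Longrightarrow>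
           (\<lambda>(d, x). reg n d x) \<in> borel_measurable ((\<Pi>\<^sub>M i\<in>{1..n}. borel) \<Otimes>\<^sub>M borel)"
  \<comment> \<open>true problem; the values of \<open>c\<close> outside \<open>\<Z> \<times> \<Y>\<close> play no role\<close>
    and "\<Z> \<noteq> {}" "compact \<Z>"
    and "(\<lambda>(z, y). c z y) \<in> borel_measurable borel"
    and "\<forall>z\<in>\<Z>. AE x in PX. integrable M (\<lambda>\<omega>. c z (fstar x + \<epsilon> \<omega>))"
    and "AE x in PX. lsc_on \<Z> (\<lambda>z. g z x)"
  \<comment> \<open>ambiguity set\<close>
    and "\<And>n x. n \<ge> 1 \<Longrightarrow> x \<in> \<X> \<Longrightarrow> \<mu> n x \<ge> 0 \<and> \<zeta> n x \<ge> 0"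
    and "\<And>n x \<rho>. n \<ge> 1 \<Longrightarrow> x \<in> \<X> \<Longrightarrow> \<rho> \<ge> 0 \<Longrightarrow> \<PP> n x \<rho> \<subseteq> prob_vectors n"
    and "\<And>n x. n \<ge> 1 \<Longrightarrow> x \<in> \<X> \<Longrightarrow> \<PP> n x 0 = {uniform_weights n}"
    and "\<And>n x. n \<ge> 1 \<Longrightarrow> x \<in> \<X> \<Longrightarrow> set_tendsto (\<PP> n x) (\<PP> n x 0) (at_right 0)"
  \<comment> \<open>the objective of the ER-DRO problem is real-valued (so that the real suprema \<open>obj\<close> are
      genuine) and lower semicontinuous (so that the infimum \<open>vdro\<close> is attained)\<close>
    and "\<And>n x \<omega>. n \<ge> 1 \<Longrightarrow> x \<in> \<X> \<Longrightarrow> \<omega> \<in> space M \<Longrightarrow>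
           \<P>hat n x \<omega> \<noteq> {} \<and> (\<forall>z\<in>\<Z>. bdd_above ((\<lambda>Q. \<integral>y. c z y \<partial>Q) ` \<P>hat n x \<omega>))"
    and "\<And>n x \<omega>. n \<ge> 1 \<Longrightarrow> x \<in> \<X> \<Longrightarrow> \<omega> \<in> space M \<Longrightarrow> lsc_on \<Z> (obj n x \<omega>)"
    and "\<And>n x. n \<ge> 1 \<Longrightarrow> x \<in> \<X> \<Longrightarrow> vdro n x \<in> borel_measurable M"
  \<comment> \<open>hypotheses (i) to (v)\<close>
    and i: "\<forall>z\<in>\<Z>. (L z)-lipschitz_on \<Y> (c z)" "bdd_above (L ` \<Z>)"
    and ii: "AE x in PX.
           (\<forall>z\<in>\<Z>. integrable M (\<lambda>\<omega>. (c z (fstar x + \<epsilon> \<omega>))\<^sup>2)) \<and>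
           bdd_above ((\<lambda>z. \<integral>\<omega>. (c z (fstar x + \<epsilon> \<omega>))\<^sup>2 \<partial>M) ` \<Z>) \<and>
           tendsto_0_in_prob M (\<lambda>n \<omega>. SUP z\<in>\<Z>.
             ereal \<bar>(\<Sum>i=1..n. (c z (fstar x + \<epsilon>d i \<omega>))\<^sup>2) / real n
                    - (\<integral>\<omega>. (c z (fstar x + \<epsilon> \<omega>))\<^sup>2 \<partial>M)\<bar>)"
    and iii: "prob_space N"
        "AE x in PX.
           (\<lambda>z\<in>\<Z>. g z x) \<in> mspace (C_space \<Z>) \<and>
           (\<forall>n\<ge>1. (\<lambda>\<omega>. \<lambda>z\<in>\<Z>. gn n z x \<omega>) \<in> measurable M (borel_of_metric (C_space \<Z>))) \<and>
           V x \<in> measurable N (borel_of_metric (C_space \<Z>)) \<and>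
           conv_in_distribution (C_space \<Z>)
             M (\<lambda>n \<omega>. \<lambda>z\<in>\<Z>. sqrt (real n) * (gn n z x \<omega> - g z x)) N (V x)"
    and iv: "0 < r" "r \<le> 1"
        "AE x in PX.
           stoch_bigo M (\<lambda>n \<omega>. (norm (fstar x - fhat n \<omega> x))\<^sup>2) (\<lambda>n. real n powr (- r)) \<and>
           stoch_bigo M (\<lambda>n \<omega>. (\<Sum>i=1..n. (norm (fstar (xd i \<omega>) - fhat n \<omega> (xd i \<omega>)))\<^sup>2) / real n)
             (\<lambda>n. real n powr (- r))"
    and v: "AE x in PX.
           (\<lambda>n. SUP p\<in>\<PP> n x (\<zeta> n x). \<Sum>i=1..n. (p i - 1 / real n)\<^sup>2)
             \<in> O(\<lambda>n. real n powr (- (1 + r)))"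
        "AE x in PX. (\<lambda>n. \<mu> n x) \<in> O(\<lambda>n. real n powr (- (r / 2)))"
  shows "AE x in PX.
           stoch_bigo M (\<lambda>n \<omega>. \<bar>vdro n x \<omega> - vstar x\<bar>) (\<lambda>n. real n powr (- (r / 2))) \<and>
           (\<forall>zhat :: nat \<Rightarrow> 'w \<Rightarrow> 'z.
              (\<forall>n\<ge>1. zhat n \<in> borel_measurable M \<and>
                 (\<forall>\<omega>\<in>space M. is_arg_min (obj n x \<omega>) (\<lambda>z. z \<in> \<Z>) (zhat n \<omega>))) \<longrightarrow>
              stoch_bigo M (\<lambda>n \<omega>. \<bar>g (zhat n \<omega>) x - vstar x\<bar>) (\<lambda>n. real n powr (- (r / 2))))"
proof -
  interpret prob_space M by fact
  have f_meas [measurable]: "fstar \<in> borel_measurable borel"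
    using assms(19) by (simp add: regression_function_def)
  note [measurable] = \<open>X \<in> borel_measurable M\<close> \<open>Y \<in> borel_measurable M\<close>
  have \<epsilon>_meas [measurable]: "\<epsilon> \<in> borel_measurable M"
    unfolding \<epsilon>_def by measurable
  have Y_closed: "closed \<Y>"
    unfolding \<Y>_def by (rule closed_dist_support)
  then have [measurable]: "\<Y> \<in> sets borel"
    by (rule borel_closed)
  \<comment> \<open>The conditions on radii, weights and objective are imposed on the support of
    \<open>X\<close>, so this makes them available for almost every \<open>x\<close>.\<close>
  have AE_X: "AE x in PX. x \<in> \<X>"
    unfolding PX_def \<X>_def by (rule AE_in_dist_support) simp
  have "AE y in distr M borel Y. y \<in> \<Y>"
    unfolding \<Y>_def by (rule AE_in_dist_support) simp
  then have "AE \<omega> in M. Y \<omega> \<in> \<Y>"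
    by (simp add: AE_distr_iff)
  \<comment> \<open>The sum is \<open>Y\<close> itself; independence of error and covariate then
    allows \<open>X \<omega>\<close> to be frozen at \<open>x\<close>.\<close>
  then have "AE \<omega> in M. fstar (X \<omega>) + \<epsilon> \<omega> \<in> \<Y>"
    by (simp add: \<epsilon>_def)
  then have AE_\<Y>: "AE x in PX. AE \<omega> in M. fstar x + \<epsilon> \<omega> \<in> \<Y>"
    unfolding PX_def using assms(20)
    by (intro AE_indep_set_vimage[where S = borel and P = "\<lambda>x e. fstar x + e \<in> \<Y>"]) simp_all
  \<comment> \<open>Each data pair has the law of \<open>(Y, X)\<close>, so its error inherits the
    membership from \<epsilon>; countably many indices still give one null set.\<close>
  have AE_data: "AE \<omega> in M. \<forall>i\<ge>1. fstar x + \<epsilon>d i \<omega> \<in> \<Y>"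
    if x: "AE \<omega> in M. fstar x + \<epsilon> \<omega> \<in> \<Y>" for x
  proof -
    define T where "T = {p. fstar x + (fst p - fstar (snd p)) \<in> \<Y>}"
    have "{p \<in> space (borel \<Otimes>\<^sub>M borel). fstar x + (fst p - fstar (snd p)) \<in> \<Y>} \<in> sets (borel \<Otimes>\<^sub>M borel)"
      by measurable
    then have T: "T \<in> sets borel"
      unfolding borel_prod by (simp add: T_def)
    have "AE p in distr M borel (\<lambda>\<omega>. (Y \<omega>, X \<omega>)). p \<in> T"
      using x T by (subst AE_distr_iff) (auto simp: T_def \<epsilon>_def)
    then have "AE \<omega> in M. (yd i \<omega>, xd i \<omega>) \<in> T" if i: "i \<ge> 1" for i
      unfolding assms(24)[OF i, symmetric] using T assms(22,23)[OF i]
      by (subst (asm) AE_distr_iff) auto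
    then have "AE \<omega> in M. i \<ge> 1 \<longrightarrow> (yd i \<omega>, xd i \<omega>) \<in> T" for i
      by (cases "i \<ge> 1") auto
    then show ?thesis
      by (simp add: AE_all_countable T_def \<epsilon>d_def)
  qed
  obtain L0 where L0: "\<And>z. z \<in> \<Z> \<Longrightarrow> L z \<le> L0"
    using i(2) by (auto simp: bdd_above_def)
  have lip: "L0-lipschitz_on \<Y> (c z)" if "z \<in> \<Z>" for z
    using i(1) that L0[OF that] by (blast intro: lipschitz_on_mono)
  have c_meas: "c z \<in> borel_measurable borel" for z
  proof -
    have "(\<lambda>y. (\<lambda>(z, y). c z y) (z, y)) \<in> borel_measurable borel"
      by (rule measurable_compose[OF _ assms(28)]) (simp flip: borel_prod)
    then show ?thesis by simp
  qed

  show ?thesis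
    using AE_X AE_\<Y> ii iii(2) iv(3) v
  proof eventually_elim
    case (elim x)

    \<comment> \<open>Rate and sampling error at a fixed covariate\<close>
    note x = elim(1) and data = AE_data[OF elim(2)]
    have gC: "(\<lambda>z\<in>\<Z>. g z x) \<in> mspace (C_space \<Z>)"
      and gn_meas: "\<And>n. n \<ge> 1 \<Longrightarrow> (\<lambda>\<omega>. \<lambda>z\<in>\<Z>. gn n z x \<omega>) \<in> measurable M (borel_of_metric (C_space \<Z>))"
      and V_meas: "V x \<in> measurable N (borel_of_metric (C_space \<Z>))"
      and conv: "conv_in_distribution (C_space \<Z>)
          M (\<lambda>n \<omega>. \<lambda>z\<in>\<Z>. sqrt (real n) * (gn n z x \<omega> - g z x)) N (V x)"
      using elim(4) by blast+
    have zeroC: "(\<lambda>z\<in>\<Z>. 0) \<in> mspace (C_space \<Z>)"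
      using \<open>compact \<Z>\<close> by (simp add: mspace_C_space cong: continuous_on_cong)
    \<comment> \<open>Continuity on a compact set bounds the true objective below, making
      \<open>vstar x\<close> a genuine infimum, and later yields measurability of its value at the
      random solution.\<close>
    have g_cont: "continuous_on \<Z> (\<lambda>z. g z x)"
      using gC \<open>compact \<Z>\<close> by (simp add: mspace_C_space cong: continuous_on_cong)
    then have g_bdd: "bdd_below ((\<lambda>z. g z x) ` \<Z>)"
      using \<open>compact \<Z>\<close> by (intro bounded_imp_bdd_below compact_imp_bounded compact_continuous_image)
    define t where "t n = real n powr (- (r / 2))" for n
    have t_pos: "t n > 0" if "n \<ge> 1" for n
      using that by (simp add: t_def)
    have t_sq: "(t n)\<^sup>2 = real n powr (- r)" for n
      by (simp add: t_def power2_eq_square flip: powr_add)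
    have t_sq': "real n * real n powr (- (1 + r)) = (t n)\<^sup>2" if "n \<ge> 1" for n
      using that by (simp add: t_sq powr_mult_base)
    have t_le: "t n \<le> 1" if "n \<ge> 1" for n
      using that iv(1) by (simp add: t_def powr_minus inverse_le_1_iff ge_one_powr_ge_zero)
    \<comment> \<open>This is where \<open>r \<le> 1\<close> enters: the sampling error of order
      n^(-1/2) is no larger in order than \<open>t n\<close>.\<close>
    have sqrt_t: "1 \<le> t n * sqrt (real n)" if "n \<ge> 1" for n
    proof -
      have "t n * sqrt (real n) = real n powr ((1 - r) / 2)"
        using that by (simp add: t_def powr_half_sqrt[symmetric] diff_divide_distrib flip: powr_add)
      then show ?thesis
        using that iv(2) by (simp add: ge_one_powr_ge_zero)
    qed

    define dev where "dev n \<omega> = mdist (C_space \<Z>) (\<lambda>z\<in>\<Z>. 0)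
        (\<lambda>z\<in>\<Z>. sqrt (real n) * (gn n z x \<omega> - g z x))" for n \<omega>
    have gnC: "(\<lambda>z\<in>\<Z>. gn n z x \<omega>) \<in> mspace (C_space \<Z>)" if "n \<ge> 1" "\<omega> \<in> space M" for n \<omega>
      using measurable_space[OF gn_meas[OF that(1)] that(2)]
      by (simp add: borel_of_metric_def space_measure_of_conv)
    have dev_eq: "dev n \<omega> = sqrt (real n) * mdist (C_space \<Z>) (\<lambda>z\<in>\<Z>. gn n z x \<omega>) (\<lambda>z\<in>\<Z>. g z x)"
      if "n \<ge> 1" "\<omega> \<in> space M" for n \<omega>
    proof -
      have "(\<lambda>z\<in>\<Z>. sqrt (real n) * (gn n z x \<omega> - g z x)) =
          (\<lambda>z\<in>\<Z>. sqrt (real n) * ((\<lambda>z\<in>\<Z>. gn n z x \<omega>) z - (\<lambda>z\<in>\<Z>. g z x) z))"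
        by (simp cong: restrict_cong)
      then show ?thesis
        unfolding dev_def using mdist_C_space_scaled_diff[OF \<open>compact \<Z>\<close> \<open>\<Z> \<noteq> {}\<close> gnC[OF that] gC, of "sqrt (real n)"] that(1)
        by simp
    qed
    \<comment> \<open>Only \<open>gn\<close> is given as a random element of the function space,
      hence the detour through its distance to the fixed function \<open>g\<close>.\<close>
    have dev_meas: "dev n \<in> borel_measurable M" if n: "n \<ge> 1" for n
    proof -
      have "continuous_map (mtopology_of (C_space \<Z>)) euclideanreal (\<lambda>h. mdist (C_space \<Z>) h (\<lambda>z\<in>\<Z>. g z x))"
        using gC by (intro continuous_map_mdist) auto
      then have "(\<lambda>\<omega>. mdist (C_space \<Z>) (\<lambda>z\<in>\<Z>. gn n z x \<omega>) (\<lambda>z\<in>\<Z>. g z x)) \<in> borel_measurable M"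
        by (rule measurable_borel_of_metric_compose[OF gn_meas[OF n]])
      then have "(\<lambda>\<omega>. sqrt (real n) * mdist (C_space \<Z>) (\<lambda>z\<in>\<Z>. gn n z x \<omega>) (\<lambda>z\<in>\<Z>. g z x)) \<in> borel_measurable M"
        by simp
      then show ?thesis
        using dev_eq[OF n] by (subst measurable_cong) auto
    qed
    have gn_dev: "\<bar>gn n z x \<omega> - g z x\<bar> \<le> dev n \<omega> * t n"
      if n: "n \<ge> 1" and "\<omega> \<in> space M" "z \<in> \<Z>" for n \<omega> z
    proof -
      define m where "m = mdist (C_space \<Z>) (\<lambda>z\<in>\<Z>. gn n z x \<omega>) (\<lambda>z\<in>\<Z>. g z x)"
      have m: "\<bar>gn n z x \<omega> - g z x\<bar> \<le> m"
        using mdist_C_space_le[OF gnC[OF that(1,2)] gC \<open>\<Z> \<noteq> {}\<close>, of m] \<open>z \<in> \<Z>\<close> by (simp add: m_def)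
      also have "m \<le> m * (t n * sqrt (real n))"
        using sqrt_t[OF n] order_trans[OF abs_ge_zero m] by (intro mult_le_cancel_left1[THEN iffD2]) simp
      also have "\<dots> = dev n \<omega> * t n"
        using that by (simp add: dev_eq m_def)
      finally show ?thesis .
    qed

    \<comment> \<open>Uniform closeness of the robust and the true objective\<close>
    obtain B0 where B0: "\<And>z. z \<in> \<Z> \<Longrightarrow> (\<integral>\<omega>. (c z (fstar x + \<epsilon> \<omega>))\<^sup>2 \<partial>M) \<le> B0"
      using elim(3) by (auto simp: bdd_above_def)
    obtain C\<^sub>s where C\<^sub>s: "\<forall>\<^sub>F n in sequentially. norm (SUP p\<in>\<PP> n x (\<zeta> n x). \<Sum>i=1..n. (p i - 1 / real n)\<^sup>2)
        \<le> C\<^sub>s * norm (real n powr (- (1 + r)))"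
      using elim(6) by (elim landau_o.bigE)
    obtain C\<^sub>\<mu> where C\<^sub>\<mu>: "\<forall>\<^sub>F n in sequentially. norm (\<mu> n x) \<le> C\<^sub>\<mu> * norm (real n powr (- (r / 2)))"
      using elim(7) by (elim landau_o.bigE)

    have key: "\<exists>C. with_prob M \<delta> (\<lambda>n \<omega>. \<forall>z\<in>\<Z>. \<bar>obj n x \<omega> z - g z x\<bar> \<le> C * t n)" if \<delta>: "\<delta> > 0" for \<delta>
    proof -
      \<comment> \<open>Four events, each failing with probability at most
        \<open>\<delta> / 4\<close>: small regression error at \<open>x\<close>, small mean squared
        regression error on the data, controlled empirical second moments of the cost, and bounded
        scaled sampling error.\<close>
      define E1 where "E1 K n \<omega> \<longleftrightarrow> \<bar>(norm (fstar x - fhat n \<omega> x))\<^sup>2\<bar> \<le> K * \<bar>real n powr (- r)\<bar>" for K n \<omega>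
      define E2 where "E2 K n \<omega> \<longleftrightarrow>
          \<bar>(\<Sum>i=1..n. (norm (fstar (xd i \<omega>) - fhat n \<omega> (xd i \<omega>)))\<^sup>2) / real n\<bar> \<le> K * \<bar>real n powr (- r)\<bar>" for K n \<omega>
      \<comment> \<open>The threshold 1 is arbitrary: it bounds the empirical second moments by
        \<open>B0 + 1\<close> simultaneously for all decisions.\<close>
      define E3 where "E3 n \<omega> \<longleftrightarrow> (SUP z\<in>\<Z>. ereal \<bar>(\<Sum>i=1..n. (c z (fstar x + \<epsilon>d i \<omega>))\<^sup>2) / real n
          - (\<integral>\<omega>. (c z (fstar x + \<epsilon> \<omega>))\<^sup>2 \<partial>M)\<bar>) \<le> ereal 1" for n \<omega>
      define E4 where "E4 K n \<omega> \<longleftrightarrow> dev n \<omega> \<le> K" for K n \<omega>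
      have \<delta>4: "\<delta> / 4 > 0"
        using \<delta> by simp
      have "\<exists>K>0. with_prob M (\<delta> / 4) (E1 K)"
        unfolding E1_def using conjunct1[OF elim(5)] \<delta>4 by (rule stoch_bigoD)
      then obtain K1 where K1: "with_prob M (\<delta> / 4) (E1 K1)"
        by auto
      have "\<exists>K>0. with_prob M (\<delta> / 4) (E2 K)"
        unfolding E2_def using conjunct2[OF elim(5)] \<delta>4 by (rule stoch_bigoD)
      then obtain K2 where K2: "with_prob M (\<delta> / 4) (E2 K2)"
        by auto
      have K3: "with_prob M (\<delta> / 4) E3"
        unfolding E3_def using elim(3) \<delta>4 by (intro tendsto_0_in_probD) simp_all
      have "\<exists>K>0. with_prob M (\<delta> / 4) (E4 K)"
        unfolding E4_def dev_def
        by (rule conv_in_distribution_imp_tight[OF conv iii(1) V_meas zeroC dev_meas[unfolded dev_def] \<delta>4])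
      then obtain K4 where K4: "with_prob M (\<delta> / 4) (E4 K4)"
        by auto
      \<comment> \<open>All summands but \<open>K4\<close> form the constant of
        \<open>ambiguity_sup_deviation\<close> for the common Lipschitz constant \<open>L0\<close>;
        \<open>K4\<close> comes from the sampling error.\<close>
      define C where "C = L0 * (C\<^sub>\<mu> + sqrt K1 + (1 + sqrt C\<^sub>s) * sqrt K2) + sqrt C\<^sub>s * sqrt (B0 + 1) + K4"
      have "with_prob M (\<delta> / 4 + (\<delta> / 4 + (\<delta> / 4 + \<delta> / 4)))
          (\<lambda>n \<omega>. E1 K1 n \<omega> \<and> E2 K2 n \<omega> \<and> E3 n \<omega> \<and> E4 K4 n \<omega>)"
        by (intro with_prob_conj K1 K2 K3 K4)
      then have "with_prob M \<delta> (\<lambda>n \<omega>. E1 K1 n \<omega> \<and> E2 K2 n \<omega> \<and> E3 n \<omega> \<and> E4 K4 n \<omega>)"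
        by simp
      then have "with_prob M \<delta> (\<lambda>n \<omega>. \<forall>z\<in>\<Z>. \<bar>obj n x \<omega> z - g z x\<bar> \<le> C * t n)"
      proof (rule with_prob_AE_mono)
        show "\<forall>\<^sub>F n in sequentially. AE \<omega> in M. E1 K1 n \<omega> \<and> E2 K2 n \<omega> \<and> E3 n \<omega> \<and> E4 K4 n \<omega> \<longrightarrow>
            (\<forall>z\<in>\<Z>. \<bar>obj n x \<omega> z - g z x\<bar> \<le> C * t n)"
          using C\<^sub>s C\<^sub>\<mu> eventually_ge_at_top[of 1]
        proof eventually_elim
          fix n :: nat
          assume s_n: "norm (SUP p\<in>\<PP> n x (\<zeta> n x). \<Sum>i=1..n. (p i - 1 / real n)\<^sup>2)
                \<le> C\<^sub>s * norm (real n powr (- (1 + r)))"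
            and \<mu>_n: "norm (\<mu> n x) \<le> C\<^sub>\<mu> * norm (real n powr (- (r / 2)))" and n: "1 \<le> n"
          have s_le: "real n * (SUP p\<in>\<PP> n x (\<zeta> n x). \<Sum>i=1..n. (p i - 1 / real n)\<^sup>2) \<le> C\<^sub>s * (t n)\<^sup>2"
          proof -
            have "(SUP p\<in>\<PP> n x (\<zeta> n x). \<Sum>i=1..n. (p i - 1 / real n)\<^sup>2) \<le> C\<^sub>s * real n powr (- (1 + r))"
              using s_n by simp
            then have "real n * (SUP p\<in>\<PP> n x (\<zeta> n x). \<Sum>i=1..n. (p i - 1 / real n)\<^sup>2)
                \<le> real n * (C\<^sub>s * real n powr (- (1 + r)))"
              by (rule mult_left_mono) simp
            also have "\<dots> = C\<^sub>s * (t n)\<^sup>2"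
              using t_sq'[OF n] by (simp add: mult.left_commute)
            finally show ?thesis .
          qed
          have \<mu>_le: "\<mu> n x \<le> C\<^sub>\<mu> * t n"
            using \<mu>_n by (simp add: t_def)
          show "AE \<omega> in M. E1 K1 n \<omega> \<and> E2 K2 n \<omega> \<and> E3 n \<omega> \<and> E4 K4 n \<omega> \<longrightarrow>
            (\<forall>z\<in>\<Z>. \<bar>obj n x \<omega> z - g z x\<bar> \<le> C * t n)"
            using data AE_space
          proof eventually_elim
            fix \<omega> assume e: "\<forall>i\<ge>1. fstar x + \<epsilon>d i \<omega> \<in> \<Y>" and \<omega>: "\<omega> \<in> space M"
            show "E1 K1 n \<omega> \<and> E2 K2 n \<omega> \<and> E3 n \<omega> \<and> E4 K4 n \<omega> \<longrightarrow>
              (\<forall>z\<in>\<Z>. \<bar>obj n x \<omega> z - g z x\<bar> \<le> C * t n)"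
            proof (intro impI ballI, elim conjE)
              fix z assume E: "E1 K1 n \<omega>" "E2 K2 n \<omega>" "E3 n \<omega>" "E4 K4 n \<omega>" and z: "z \<in> \<Z>"
              define U where "U = (\<Sum>i=1..n. (c z (fstar x + \<epsilon>d i \<omega>))\<^sup>2) / real n"
              have "ereal \<bar>U - (\<integral>\<omega>. (c z (fstar x + \<epsilon> \<omega>))\<^sup>2 \<partial>M)\<bar> \<le> ereal 1"
                using SUP_upper[OF z] E(3) unfolding E3_def U_def by (rule order_trans)
              then have U: "U \<le> B0 + 1"
                using B0[OF z] by simp
              have "\<bar>obj n x \<omega> z - gn n z x \<omega>\<bar>
                \<le> (L0 * (C\<^sub>\<mu> + sqrt K1 + (1 + sqrt C\<^sub>s) * sqrt K2) + sqrt C\<^sub>s * sqrt (B0 + 1)) * t n"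
                unfolding obj_def gn_def \<P>hat_def
              proof (rule ambiguity_sup_deviation[where a = "norm (fstar x - fhat n \<omega> x)"
                    and b = "\<lambda>i. norm (fstar (xd i \<omega>) - fhat n \<omega> (xd i \<omega>))"])
                show "\<PP> n x (\<zeta> n x) \<subseteq> prob_vectors n"
                  using assms(31,32) n x by blast
                show "ambiguity_set n (\<PP> n x (\<zeta> n x))
                  (\<lambda>i. proj_ball \<Y> (fhat n \<omega> x + \<epsilon>hat n i \<omega>) (\<mu> n x)) \<noteq> {}"
                  using assms(35)[OF n x \<omega>] by (simp add: \<P>hat_def)
                show "norm (fhat n \<omega> x + \<epsilon>hat n i \<omega> - (fstar x + \<epsilon>d i \<omega>))
                  \<le> norm (fstar x - fhat n \<omega> x) + norm (fstar (xd i \<omega>) - fhat n \<omega> (xd i \<omega>))" for i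
                proof -
                  \<comment> \<open>The observation \<open>yd i \<omega>\<close> cancels, leaving
                    only the regression errors at the data point and at \<open>x\<close>.\<close>
                  have "fhat n \<omega> x + \<epsilon>hat n i \<omega> - (fstar x + \<epsilon>d i \<omega>)
                      = (fstar (xd i \<omega>) - fhat n \<omega> (xd i \<omega>)) - (fstar x - fhat n \<omega> x)"
                    by (simp add: \<epsilon>hat_def \<epsilon>d_def)
                  then show ?thesis
                    by (metis add.commute norm_triangle_ineq4)
                qed
                show "fstar x + \<epsilon>d i \<omega> \<in> \<Y>" if "i \<in> {1..n}" for i
                  using e that by simp
                show "(norm (fstar x - fhat n \<omega> x))\<^sup>2 \<le> K1 * (t n)\<^sup>2"
                  using E(1) by (simp add: E1_def t_sq)
                show "(\<Sum>i=1..n. (norm (fstar (xd i \<omega>) - fhat n \<omega> (xd i \<omega>)))\<^sup>2) / real n \<le> K2 * (t n)\<^sup>2"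
                  using order_trans[OF abs_ge_self E(2)[unfolded E2_def]] by (simp add: t_sq)
                show "(\<Sum>i=1..n. (c z (fstar x + \<epsilon>d i \<omega>))\<^sup>2) / real n \<le> B0 + 1"
                  using U by (simp add: U_def)
              qed (use n Y_closed \<open>convex \<Y>\<close> \<open>\<Y> \<noteq> {}\<close> c_meas lip[OF z] t_pos[OF n] t_le[OF n] s_le \<mu>_le in simp_all)
              moreover have "\<bar>gn n z x \<omega> - g z x\<bar> \<le> K4 * t n"
                using gn_dev[OF n \<omega> z] E(4) t_pos[OF n] unfolding E4_def
                by (meson less_imp_le mult_right_mono order_trans)
              ultimately show "\<bar>obj n x \<omega> z - g z x\<bar> \<le> C * t n"
                unfolding C_def distrib_right[of _ K4] by linarith
            qed
          qed
        qed
      qed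
      then show ?thesis by (rule exI)
    qed

    \<comment> \<open>From closeness of objectives to optimal value and optimal solution\<close>
    show ?case
    proof (intro conjI allI impI)
      show "stoch_bigo M (\<lambda>n \<omega>. \<bar>vdro n x \<omega> - vstar x\<bar>) (\<lambda>n. real n powr (- (r / 2)))"
        unfolding t_def[symmetric]
      proof (rule stoch_bigoI[OF _ t_pos])
        show "(\<lambda>\<omega>. \<bar>vdro n x \<omega> - vstar x\<bar>) \<in> borel_measurable M" if "n \<ge> 1" for n
          using assms(37)[OF that x] by simp
        fix \<delta> :: real assume \<delta>: "\<delta> > 0"
        from key[OF \<delta>] obtain C where C: "with_prob M \<delta> (\<lambda>n \<omega>. \<forall>z\<in>\<Z>. \<bar>obj n x \<omega> z - g z x\<bar> \<le> C * t n)" ..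
        have "with_prob M \<delta> (\<lambda>n \<omega>. \<bar>\<bar>vdro n x \<omega> - vstar x\<bar>\<bar> \<le> C * t n)"
        proof (rule with_prob_AE_mono[OF C], intro always_eventually allI AE_I2 impI)
          fix n \<omega> assume "\<forall>z\<in>\<Z>. \<bar>obj n x \<omega> z - g z x\<bar> \<le> C * t n"
          then show "\<bar>\<bar>vdro n x \<omega> - vstar x\<bar>\<bar> \<le> C * t n"
            unfolding vdro_def vstar_def abs_abs using \<open>\<Z> \<noteq> {}\<close> g_bdd
            by (intro abs_INF_diff_le(2)) auto
        qed
        then show "\<exists>C. with_prob M \<delta> (\<lambda>n \<omega>. \<bar>\<bar>vdro n x \<omega> - vstar x\<bar>\<bar> \<le> C * t n)"
          by (rule exI)
      qed
    next
      fix zhat :: "nat \<Rightarrow> 'w \<Rightarrow> 'z"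
      assume zhat: "\<forall>n\<ge>1. zhat n \<in> borel_measurable M \<and>
          (\<forall>\<omega>\<in>space M. is_arg_min (obj n x \<omega>) (\<lambda>z. z \<in> \<Z>) (zhat n \<omega>))"
      show "stoch_bigo M (\<lambda>n \<omega>. \<bar>g (zhat n \<omega>) x - vstar x\<bar>) (\<lambda>n. real n powr (- (r / 2)))"
        unfolding t_def[symmetric]
      proof (rule stoch_bigoI[OF _ t_pos])
        show "(\<lambda>\<omega>. \<bar>g (zhat n \<omega>) x - vstar x\<bar>) \<in> borel_measurable M" if "n \<ge> 1" for n
        proof -
          \<comment> \<open>\<open>g\<close> is known to be continuous on \<open>\<Z>\<close> only;
            since solutions take values there, the composition is measured through the restricted
            Borel space.\<close>
          have "zhat n \<in> measurable M (restrict_space borel \<Z>)"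
            using zhat that by (auto simp: measurable_restrict_space2_iff is_arg_min_def)
          then have "(\<lambda>\<omega>. g (zhat n \<omega>) x) \<in> borel_measurable M"
            by (rule measurable_compose) (rule borel_measurable_continuous_on_restrict[OF g_cont])
          then show ?thesis by simp
        qed
        fix \<delta> :: real assume \<delta>: "\<delta> > 0"
        from key[OF \<delta>] obtain C where C: "with_prob M \<delta> (\<lambda>n \<omega>. \<forall>z\<in>\<Z>. \<bar>obj n x \<omega> z - g z x\<bar> \<le> C * t n)" ..
        have "with_prob M \<delta> (\<lambda>n \<omega>. \<bar>\<bar>g (zhat n \<omega>) x - vstar x\<bar>\<bar> \<le> 2 * C * t n)"
        proof (rule with_prob_AE_mono[OF C])
          show "\<forall>\<^sub>F n in sequentially. AE \<omega> in M. (\<forall>z\<in>\<Z>. \<bar>obj n x \<omega> z - g z x\<bar> \<le> C * t n) \<longrightarrow>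
              \<bar>\<bar>g (zhat n \<omega>) x - vstar x\<bar>\<bar> \<le> 2 * C * t n"
            using eventually_ge_at_top[of 1]
          proof (eventually_elim, intro AE_I2 impI)
            fix n \<omega> assume "1 \<le> n" "\<omega> \<in> space M" "\<forall>z\<in>\<Z>. \<bar>obj n x \<omega> z - g z x\<bar> \<le> C * t n"
            then show "\<bar>\<bar>g (zhat n \<omega>) x - vstar x\<bar>\<bar> \<le> 2 * C * t n"
              unfolding vstar_def abs_abs mult.assoc using zhat g_bdd
              by (intro is_arg_min_perturbed_gap[where f = "obj n x \<omega>"]) auto
          qed
        qed
        then show "\<exists>C. with_prob M \<delta> (\<lambda>n \<omega>. \<bar>\<bar>g (zhat n \<omega>) x - vstar x\<bar>\<bar> \<le> C * t n)"
          by (rule exI)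
      qed
    qed
  qed
qed

end
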